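(* Let $f$ be a suitable function with associated constants $b,\lambda$ and coefficient functions $f_m$. Let $\alpha>0$, $I_\alpha(f;n):=\int_1^\infty(\log t)^ne^{-\alpha t}f(t)\,dt$ for $n>0$, and $u:=W(n/\alpha)$. For each integer $R\ge1$, as $n\to\infty$, $$I_\alpha(f;n)=\sqrt{2\pi}\,\frac{u^{n+1}f(e^u)e^{u-n/u}}{\sqrt{(1+u)n}}\left(1+\sum_{r=1}^{R-1}\frac{a_r(f;u)}{n^r}+O\!\left(\frac{u^{R(1+2\lambda)}}{n^R}\right)\right),$$ where the implied constant depends only on $R$, $\alpha$ and $b$. Moreover $a_r(f;u)\ll u^{r(1+2\lambda)}$.
   Context: A continuous $f:[1,\infty)\to\mathbb R$ is suitable if there are real constants $b,\lambda\ge0$ and functions $f_m$ ($m\in\mathbb Z_{\ge0}$) such that: (i) $0<f(t)\ll t^b$ for $t\ge1$; (ii) writing $t=e^v$ with $v\ge1$, for every integer $k\ge0$, $\frac{f(t(x+1))}{f(t)}=\sum_{m=0}^{k-1}f_m(v)x^m+O(v^{\lambda k}|x|^k)$ for $|x|\le1/(2v^\lambda)$, with implied constant depending only on $k$ and $f$; (iii) $f_m(v)\ll v^{\lambda m}$ with implied constant depending only on $m$ and $f$. $W$ is the Lambert function. Bell polynomials: $(p_1x+p_2x^2+\cdots)^j=\sum_{i\ge j}\hat B_{i,j}(p_1,p_2,\dots)x^i$. $\ell_i(v):=\sum_{j=1}^i\hat B_{i,j}(1,-\tfrac12,\tfrac13,\dots)\frac{(-1)^{j+1}}{jv^j}$ and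 $$a_r(f;v):=\sum_{j=0}^{2r}\frac{(2j+2r-1)!!}{j!}\left(\frac{v^2}{v+1}\right)^{j+r}\sum_{i=j}^{2r}\hat B_{i,j}(\ell_3(v),\ell_4(v),\dots)f_{2r-i}(v),$$ with $(-1)!!=1$.
   Formalization: The implied constant may depend, besides R, α and b, on the implied constants in conditions (ii) and (iii) of suitability; with R, α, b alone the claim fails, e.g. for f(t)=2+sin(N log t), b=λ=0, R=1, N→∞. *)

theory Defs
  imports "HOL-Analysis.Analysis" "HOL-Computational_Algebra.Formal_Power_Series"
begin

text \<open>Principal branch of the Lambert function; meaningful for \<open>x \<ge> - exp (-1)\<close>.\<close>

definition Lambert_W :: "real \<Rightarrow> real" where
  "Lambert_W x = (THE w. w \<ge> -1 \<and> w * exp w = x)"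

text \<open>Integer argument, so that \<open>double_fact (-1) = 1\<close> (an empty product).\<close>

definition double_fact :: "int \<Rightarrow> int" where
  "double_fact k = \<Prod>{i \<in> {1..k}. even (k - i)}"

text \<open>
  Partial ordinary Bell polynomial: the coefficient of \<open>x ^ i\<close> in
  \<open>(p 1 * x + p 2 * x\<^sup>2 + \<dots>) ^ j\<close>. The value \<open>p 0\<close> is ignored.
\<close>

definition bell_hat :: "nat \<Rightarrow> nat \<Rightarrow> (nat \<Rightarrow> real) \<Rightarrow> real" where
  "bell_hat i j p = fps_nth (Abs_fps (\<lambda>m. if m = 0 then 0 else p m) ^ j) i"

definition ell :: "nat \<Rightarrow> real \<Rightarrow> real" where
  "ell i v = (\<Sum>j=1..i. bell_hat i j (\<lambda>m. (-1) ^ (m + 1) / real m) *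
                         ((-1) ^ (j + 1) / (real j * v ^ j)))"

text \<open>
  The coefficient \<open>a\<^sub>r(f; v)\<close>; it depends on \<open>f\<close> only through its
  coefficient functions \<open>fm\<close>.
\<close>

definition a_coeff :: "(nat \<Rightarrow> real \<Rightarrow> real) \<Rightarrow> nat \<Rightarrow> real \<Rightarrow> real" where
  "a_coeff fm r v =
     (\<Sum>j=0..2*r. of_int (double_fact (2 * int j + 2 * int r - 1)) / fact j *
        (v\<^sup>2 / (v + 1)) ^ (j + r) *
        (\<Sum>i=j..2*r. bell_hat i j (\<lambda>m. ell (m + 2) v) * fm (2*r - i) v))"

text \<open>
  \<open>K k\<close> and \<open>M m\<close> are admissible implied constants in, respectively, the local
  expansion of \<open>f\<close> to order \<open>k\<close> and the bound on the coefficient function \<open>fm m\<close>.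
\<close>

definition suitability_constants ::
    "(real \<Rightarrow> real) \<Rightarrow> real \<Rightarrow> (nat \<Rightarrow> real \<Rightarrow> real) \<Rightarrow> (nat \<Rightarrow> real) \<Rightarrow> (nat \<Rightarrow> real) \<Rightarrow> bool" where
  "suitability_constants f lam fm K M \<longleftrightarrow>
     (\<forall>k. \<forall>v\<ge>1. \<forall>x. \<bar>x\<bar> \<le> 1 / (2 * v powr lam) \<longrightarrow>
        \<bar>f (exp v * (x + 1)) / f (exp v) - (\<Sum>m<k. fm m v * x ^ m)\<bar>
          \<le> K k * (v powr (lam * real k) * \<bar>x\<bar> ^ k)) \<and>
     (\<forall>m. \<forall>v\<ge>1. \<bar>fm m v\<bar> \<le> M m * v powr (lam * real m))"

definition suitable ::
    "(real \<Rightarrow> real) \<Rightarrow> real \<Rightarrow> real \<Rightarrow> (nat \<Rightarrow> real \<Rightarrow> real) \<Rightarrow> bool" where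
  "suitable f b lam fm \<longleftrightarrow>
     continuous_on {1..} f \<and> b \<ge> 0 \<and> lam \<ge> 0 \<and>
     (\<exists>A. \<forall>t\<ge>1. 0 < f t \<and> f t \<le> A * t powr b) \<and>
     (\<exists>K M. suitability_constants f lam fm K M)"

definition I_int :: "real \<Rightarrow> (real \<Rightarrow> real) \<Rightarrow> real \<Rightarrow> real" where
  "I_int \<alpha> f n = (LINT t:{1..}|lborel. ln t powr n * exp (- \<alpha> * t) * f t)"

end

theory Submission
  imports Defs "HOL-Probability.Distributions"
begin

text \<open>
  Laplace's method. With \<open>u = W (n / \<alpha>)\<close> and \<open>N = n / u = \<alpha> e^u\<close>, the substitution \<open>t = e^u (1 + x)\<close>
  turns the integrand into a constant times \<open>exp (n (L x - x / u)) f (e^u (1 + x)) / f (e^u)\<close>, where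
  \<open>L x = ln (1 + ln (1 + x) / u)\<close> has Taylor coefficients \<open>ell i u\<close>. The linear term cancels, the quadratic
  one is \<open>- (u + 1) / (2 u^2)\<close>, and rescaling \<open>x = s y\<close> with \<open>s = u / sqrt ((u + 1) n)\<close> makes it the
  standard Gaussian. For \<open>|y| \<le> N^(1/6)\<close> the factor \<open>exp (n \<Sum>_{i \<ge> 3} ell i u x^i)\<close> and the quotient of
  \<open>f\<close> are expanded, and the Gaussian moments of the resulting polynomial are the \<open>a_r / n^r\<close>. Beyond that
  range \<open>L x \<le> ln (1 + x) / u\<close> gives a factor \<open>exp (- N^(1/6))\<close>, which beats both powers of \<open>N\<close> and the
  crude lower bound \<open>f (e^u) \<ge> m exp (- c u^(lam + 1))\<close> that follows from the local expansion of \<open>f\<close>.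
\<close>

text \<open>One error constant must serve every \<open>f\<close> with the given suitability
  constants \<open>K\<close> and \<open>M\<close>; therefore each estimate carries an explicit
  constant, and only the threshold for \<open>n\<close> may depend on \<open>f\<close>. While
  expanding in \<open>x\<close>, the factor \<open>w = n * x^2\<close> in front of the tail series
  is kept as a separate variable. After rescaling it is comparable to \<open>u * y^2\<close>, so it
  is not small; only the remaining powers of \<open>x\<close>, each worth \<open>N^(-1/2)\<close>,
  count towards the order. This is why the coefficients \<open>a_r\<close> are double sums: one
  index counts factors of \<open>w\<close>, the other powers of \<open>x\<close>. Truncation takes
  place at total degree \<open>2 * R\<close> in \<open>x\<close>: odd degrees have vanishing
  Gaussian moments, and a remainder \<open>(u^lam * |x|)^(2 * R)\<close> becomes
  \<open>(u^(2 * lam) / N)^R\<close>, which is the stated error because \<open>N = n / u\<close>.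
  The exponent 1/6 is the largest that keeps the non-Gaussian part of the phase bounded: that part
  has size \<open>n * |x|^3 / u = N * |x|^3\<close>, and \<open>|x| <= |y| / sqrt N\<close>, so
  \<open>|y|^3 <= sqrt N\<close> is what is needed.\<close>

section \<open>The Lambert function and double factorials\<close>

lemma exp_mult_self_strict_mono:
  fixes x y :: real
  assumes "0 < x" "x < y"
  shows "x * exp x < y * exp y"
  using assms by (intro mult_strict_mono) auto

text \<open>A root of \<open>w * exp w = x\<close> with \<open>x > 0\<close> must be positive, and
  there the map is strictly increasing, so the root is unique. Existence is the intermediate value
  theorem on \<open>[0, x]\<close>, as \<open>x <= x * exp x\<close>.\<close>

lemma Lambert_W_pos_eq:
  assumes "x > 0"
  shows "Lambert_W x > 0" "Lambert_W x * exp (Lambert_W x) = x"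
proof -
  have "\<exists>w\<ge>0. w \<le> x \<and> w * exp w = x"
    using assms by (intro IVT') (auto intro!: continuous_on_mult continuous_on_exp continuous_on_id)
  then obtain w where w: "w \<ge> 0" "w * exp w = x" by blast
  have pos: "z > 0" if "z * exp z = x" for z :: real
    using assms that by (metis exp_gt_zero zero_less_mult_pos2)
  have "Lambert_W x = w"
    unfolding Lambert_W_def
  proof (rule the_equality)
    show "w \<ge> - 1 \<and> w * exp w = x" using w by auto
    show "z = w" if "z \<ge> - 1 \<and> z * exp z = x" for z
      using that w pos[of z] pos[of w] exp_mult_self_strict_mono[of z w]
        exp_mult_self_strict_mono[of w z] by (cases z w rule: linorder_cases) auto
  qed
  then show "Lambert_W x > 0" "Lambert_W x * exp (Lambert_W x) = x"
    using w pos by auto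
qed

lemma filterlim_Lambert_W_at_top: "filterlim Lambert_W at_top at_top"
  unfolding filterlim_at_top_gt[where c = 0]
proof (intro allI impI)
  fix Z :: real assume "Z > 0"
  show "\<forall>\<^sub>F x in at_top. Z \<le> Lambert_W x"
    using eventually_ge_at_top[of "Z * exp Z"]
  proof eventually_elim
    case (elim x)
    have "Z * exp Z > 0" using \<open>Z > 0\<close> by simp
    with elim have "x > 0" by linarith
    with elim show ?case
      using Lambert_W_pos_eq[of x] exp_mult_self_strict_mono[of "Lambert_W x" Z]
      by linarith
  qed
qed

lemma double_fact_Suc: "double_fact (2 * int (Suc k) - 1) = (2 * int k + 1) * double_fact (2 * int k - 1)"
proof -
  have *: "{i \<in> {1..2 * int (Suc k) - 1}. even (2 * int (Suc k) - 1 - i)} =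
        insert (2 * int k + 1) {i \<in> {1..2 * int k - 1}. even (2 * int k - 1 - i)}"
    by (auto, presburger)
  have "finite {i \<in> {1..2 * int k - 1}. even (2 * int k - 1 - i)}"
    by (rule finite_subset[of _ "{1..2 * int k - 1}"]) auto
  then show ?thesis
    unfolding double_fact_def * by (subst prod.insert) auto
qed

text \<open>The closed form in which the even moments of the standard normal density are
  available.\<close>

lemma double_fact_odd: "real_of_int (double_fact (2 * int k - 1)) = fact (2 * k) / (2 ^ k * fact k)"
proof (induction k)
  case 0
  then show ?case by (simp add: double_fact_def)
next
  case (Suc k)
  have "fact (2 * Suc k) = (2 * real k + 2) * ((2 * real k + 1) * fact (2 * k))"
    by (simp add: algebra_simps)
  then show ?case
    unfolding double_fact_Suc of_int_mult Suc by (simp add: divide_simps)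
qed

section \<open>Geometric bounds for the coefficients of the phase\<close>

text \<open>In the Cauchy product, doubling the rate \<open>r\<close> leaves a factor
  \<open>(1/2)^m\<close> on the \<open>m\<close>-th term. As the constant term vanishes,
  \<open>m\<close> starts at 1 and these factors sum to at most 1, so the induction on
  \<open>j\<close> loses nothing beyond \<open>c ^ j\<close>.\<close>

lemma fps_power_nth_bound:
  fixes P :: "real fps"
  assumes "fps_nth P 0 = 0" and "\<And>m. \<bar>fps_nth P m\<bar> \<le> c * r ^ m" and "c \<ge> 0" "r \<ge> 0"
  shows "\<bar>fps_nth (P ^ j) i\<bar> \<le> c ^ j * (2 * r) ^ i"
proof (induction j arbitrary: i)
  case 0
  then show ?case using \<open>r \<ge> 0\<close> by auto
next
  case (Suc j)
  have geom: "(\<Sum>m=1..i. (1 / 2 :: real) ^ m) \<le> 1" for i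
  proof -
    have "(\<Sum>m=1..i. (1 / 2 :: real) ^ m) = 1 - (1 / 2) ^ i"
      by (induction i) auto
    then show ?thesis by simp
  qed
  have "\<bar>fps_nth (P ^ Suc j) i\<bar> = \<bar>\<Sum>m=0..i. fps_nth P m * fps_nth (P ^ j) (i - m)\<bar>"
    by (simp add: fps_mult_nth)
  also have "\<dots> = \<bar>\<Sum>m=1..i. fps_nth P m * fps_nth (P ^ j) (i - m)\<bar>"
    using assms(1) by (simp add: sum.atLeast_Suc_atMost)
  also have "\<dots> \<le> (\<Sum>m=1..i. \<bar>fps_nth P m\<bar> * \<bar>fps_nth (P ^ j) (i - m)\<bar>)"
    unfolding abs_mult[symmetric] by (rule sum_abs)
  also have "\<dots> \<le> (\<Sum>m=1..i. (c * r ^ m) * (c ^ j * (2 * r) ^ (i - m)))"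
    by (intro sum_mono mult_mono assms Suc) (use assms in auto)
  also have "\<dots> = (\<Sum>m=1..i. c ^ Suc j * (2 * r) ^ i * (1 / 2) ^ m)"
  proof (rule sum.cong[OF refl], goal_cases)
    case (1 m)
    then have "i = m + (i - m)" by simp
    then have "(2 * r) ^ i = (2 * r) ^ m * (2 * r) ^ (i - m)" by (metis power_add)
    then show ?case by (simp add: power_mult_distrib field_simps)
  qed
  also have "\<dots> = c ^ Suc j * (2 * r) ^ i * (\<Sum>m=1..i. (1 / 2) ^ m)"
    by (simp add: sum_distrib_left)
  also have "\<dots> \<le> c ^ Suc j * (2 * r) ^ i * 1"
    by (intro mult_left_mono geom) (use assms in auto)
  finally show ?case by simp
qed

text \<open>Two factors \<open>2 ^ i\<close> arise, one from the Bell polynomials of a sequence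
  bounded by 1, one from \<open>i <= 2 ^ i\<close> terms. The saving \<open>1 / v\<close>, from
  \<open>v ^ j >= v\<close>, is essential later: it offsets the growth of \<open>w\<close> and of
  \<open>v\<^sup>2 / (v + 1)\<close>.\<close>

lemma ell_bound:
  assumes "v \<ge> 1"
  shows "\<bar>ell i v\<bar> \<le> 4 ^ i / v"
proof -
  have b: "\<bar>bell_hat i j (\<lambda>m. (-1) ^ (m + 1) / real m)\<bar> \<le> 2 ^ i" for j
    unfolding bell_hat_def
    by (rule order_trans[OF fps_power_nth_bound[where c = 1 and r = 1]]) (auto simp: abs_divide)
  have "\<bar>ell i v\<bar> \<le> (\<Sum>j=1..i. 2 ^ i * (1 / v))"
    unfolding ell_def
  proof (rule order_trans[OF sum_abs], rule sum_mono, goal_cases)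
    case (1 j)
    have "1 * v \<le> real j * v ^ j"
      using 1 assms by (intro mult_mono) (auto intro: self_le_power)
    then have "1 / (real j * v ^ j) \<le> 1 / v"
      using assms by (intro divide_left_mono) auto
    then have "\<bar>(- 1) ^ (j + 1) / (real j * v ^ j)\<bar> \<le> 1 / v"
      using assms by (simp add: abs_divide abs_mult power_abs)
    then show ?case
      unfolding abs_mult using b[of j] by (intro mult_mono) auto
  qed
  also have "\<dots> = real i * 2 ^ i / v" by simp
  also have "\<dots> \<le> 2 ^ i * 2 ^ i / v"
    using assms by (intro divide_right_mono mult_right_mono) auto
  also have "\<dots> = 4 ^ i / v" by (simp add: power_mult_distrib[symmetric])
  finally show ?thesis .
qed

text \<open>The part of the phase of degree at least 3 with \<open>x\<^sup>2\<close> factored out.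
  The shift by 2 makes the powers of this series produce exactly the Bell polynomials in
  \<open>a_coeff\<close>.\<close>

definition ell_tail :: "real \<Rightarrow> real fps" where
  "ell_tail v = Abs_fps (\<lambda>m. if m = 0 then 0 else ell (m + 2) v)"

lemma bell_hat_ell_tail: "bell_hat i j (\<lambda>m. ell (m + 2) v) = fps_nth (ell_tail v ^ j) i"
  unfolding bell_hat_def ell_tail_def ..

lemma ell_tail_power_bound:
  assumes "v \<ge> 1"
  shows "\<bar>fps_nth (ell_tail v ^ j) i\<bar> \<le> (16 / v) ^ j * 8 ^ i"
  using fps_power_nth_bound[of "ell_tail v" "16 / v" 4 j i] assms ell_bound[OF assms, of "_ + 2"]
  by (auto simp: ell_tail_def)

lemma ell_tail_power_eq_0: "i < j \<Longrightarrow> fps_nth (ell_tail v ^ j) i = 0"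
  using startsby_zero_power_prefix[of "ell_tail v" j] by (simp add: ell_tail_def)

section \<open>Convergence, remainders and identification of real power series\<close>

lemma fps_conv_radius_geI_geometric:
  fixes F :: "real fps"
  assumes "\<And>m. \<bar>fps_nth F m\<bar> \<le> c * r ^ m" "r > 0"
  shows "fps_conv_radius F \<ge> ereal (1 / r)"
  unfolding fps_conv_radius_def
proof (rule conv_radius_geI_ex')
  fix z :: real assume "0 < z" "ereal z < ereal (1 / r)"
  then have z: "0 < z" "r * z < 1" using \<open>r > 0\<close> by (auto simp: field_simps)
  show "summable (\<lambda>n. fps_nth F n * of_real z ^ n)"
  proof (rule summable_comparison_test')
    show "summable (\<lambda>n. c * (r * z) ^ n)"
      using z assms by (intro summable_mult summable_geometric) auto
    show "norm (fps_nth F n * of_real z ^ n) \<le> c * (r * z) ^ n" if "n \<ge> 0" for n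
      using mult_right_mono[OF assms(1)[of n], of "z ^ n"] z
      by (simp add: abs_mult power_mult_distrib mult.assoc)
  qed
qed

text \<open>The condition on \<open>x\<close> keeps the ratio \<open>r * \<bar>x\<bar>\<close> at
  most 1/2, so the geometric tail is at most twice its first term.\<close>

lemma eval_fps_remainder:
  fixes F :: "real fps"
  assumes "\<And>m. \<bar>fps_nth F m\<bar> \<le> c * r ^ m" "r > 0" "2 * r * \<bar>x\<bar> \<le> 1"
  shows "\<bar>eval_fps F x - (\<Sum>i<k. fps_nth F i * x ^ i)\<bar> \<le> 2 * c * (r * \<bar>x\<bar>) ^ k"
proof -
  have "\<bar>x\<bar> < 1 / r"
    using assms(2,3) by (auto simp: field_simps)
  then have "ereal \<bar>x\<bar> < fps_conv_radius F"
    using fps_conv_radius_geI_geometric[of F c r, OF assms(1,2)]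
    by (auto intro: less_le_trans[of _ "ereal (1 / r)"])
  then have s: "summable (\<lambda>i. fps_nth F i * x ^ i)"
    by (intro summable_fps) auto
  have rx: "0 \<le> r * \<bar>x\<bar>" "r * \<bar>x\<bar> \<le> 1 / 2" using assms by auto
  have c: "c \<ge> 0" using assms(1)[of 0] by simp
  have g: "summable (\<lambda>i. c * (r * \<bar>x\<bar>) ^ k * (r * \<bar>x\<bar>) ^ i)"
    using rx by (intro summable_mult summable_geometric) auto
  have le: "norm (fps_nth F (i + k) * x ^ (i + k)) \<le> c * (r * \<bar>x\<bar>) ^ k * (r * \<bar>x\<bar>) ^ i" for i
    using mult_right_mono[OF assms(1)[of "i + k"], of "\<bar>x\<bar> ^ (i + k)"]
    by (simp add: abs_mult power_mult_distrib power_add power_abs mult_ac)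
  have "eval_fps F x - (\<Sum>i<k. fps_nth F i * x ^ i) = (\<Sum>i. fps_nth F (i + k) * x ^ (i + k))"
    unfolding eval_fps_def using suminf_minus_initial_segment[OF s, of k] by simp
  also have "norm \<dots> \<le> (\<Sum>i. c * (r * \<bar>x\<bar>) ^ k * (r * \<bar>x\<bar>) ^ i)"
    using norm_suminf_le[OF le g] .
  also have "\<dots> = c * (r * \<bar>x\<bar>) ^ k * (1 / (1 - r * \<bar>x\<bar>))"
    using rx by (subst suminf_mult) (auto simp: suminf_geometric)
  also have "\<dots> \<le> c * (r * \<bar>x\<bar>) ^ k * 2"
    using rx c \<open>r > 0\<close> by (intro mult_left_mono mult_nonneg_nonneg zero_le_power) (auto simp: divide_simps)
  finally show ?thesis by (simp add: mult_ac)
qed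

text \<open>The difference of the two sides has zero derivative on a ball and vanishes at 0. This
  reduces each Taylor series below to an identity for its formal derivative.\<close>

lemma eval_fps_eqI_deriv:
  fixes F :: "real fps" and g :: "real \<Rightarrow> real"
  assumes "ereal r \<le> fps_conv_radius F" "fps_nth F 0 = g 0"
    and "\<And>x. \<bar>x\<bar> < r \<Longrightarrow> (g has_real_derivative eval_fps (fps_deriv F) x) (at x)"
    and "\<bar>x\<bar> < r"
  shows "eval_fps F x = g x"
proof -
  have "\<exists>c. \<forall>y\<in>ball 0 r. eval_fps F y - g y = c"
  proof (rule has_field_derivative_zero_constant)
    show "((\<lambda>y. eval_fps F y - g y) has_field_derivative 0) (at y within ball 0 r)"
      if "y \<in> ball 0 r" for y
    proof -
      have y: "\<bar>y\<bar> < r" using that by simp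
      then have "ereal (norm y) < fps_conv_radius F"
        using assms(1) by (auto intro: less_le_trans[of _ "ereal r"])
      from has_field_derivative_eval_fps[OF this]
      have "((\<lambda>y. eval_fps F y - g y) has_field_derivative
          eval_fps (fps_deriv F) y - eval_fps (fps_deriv F) y) (at y)"
        using assms(3)[OF y] by (rule DERIV_diff)
      then show ?thesis by (simp add: has_field_derivative_at_within)
    qed
  qed auto
  then obtain c where c: "\<And>y. \<bar>y\<bar> < r \<Longrightarrow> eval_fps F y - g y = c" by auto
  have "eval_fps F 0 - g 0 = c" using c[of 0] assms(4) by simp
  then have "c = 0" using assms(2) by (simp add: eval_fps_at_0)
  with c[OF assms(4)] show ?thesis by simp
qed

section \<open>The Taylor series of \<open>ln (1 + ln (1 + x) / v)\<close>\<close>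

lemma fps_conv_radius_ln_1: "fps_conv_radius (fps_ln 1 :: real fps) \<ge> 1"
  using fps_conv_radius_geI_geometric[of "fps_ln 1" 1 1]
  by (auto simp: fps_ln_nth one_ereal_def abs_divide)

lemma eval_fps_ln_1:
  assumes "\<bar>x\<bar> < 1"
  shows "eval_fps (fps_ln 1) x = ln (1 + x :: real)"
proof (rule eval_fps_eqI_deriv[where r = 1])
  fix x :: real assume x: "\<bar>x\<bar> < 1"
  have 1: "fps_deriv (fps_ln 1) * (1 + fps_X) = (1 :: real fps)"
    by (simp add: fps_ln_deriv inverse_mult_eq_1)
  have cr: "ereal (norm x) < fps_conv_radius (fps_deriv (fps_ln 1) :: real fps)"
    by (rule less_le_trans[OF _ order_trans[OF fps_conv_radius_ln_1 fps_conv_radius_deriv]])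
       (use x in \<open>simp add: one_ereal_def\<close>)
  have cr2: "ereal (norm x) < fps_conv_radius (1 + fps_X :: real fps)"
    by (rule less_le_trans[OF _ fps_conv_radius_add]) auto
  have "eval_fps (fps_deriv (fps_ln 1)) x * (1 + x) = 1"
    using arg_cong[OF 1, of "\<lambda>F. eval_fps F x"] cr cr2
    by (simp add: eval_fps_mult eval_fps_add)
  then have "eval_fps (fps_deriv (fps_ln 1)) x = 1 / (1 + x)"
    using x by (simp add: field_simps)
  then show "((\<lambda>x. ln (1 + x)) has_real_derivative eval_fps (fps_deriv (fps_ln 1)) x) (at x)"
    using x by (auto intro!: derivative_eq_intros)
qed (use assms fps_conv_radius_ln_1 in \<open>auto simp: one_ereal_def\<close>)

text \<open>The outer series is that of \<open>ln (1 + y / v)\<close>; the Bell polynomials in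
  \<open>ell\<close> are the coefficients of the powers of the inner series
  \<open>ln (1 + x)\<close>, so the defining sum is the composition formula.\<close>

lemma ell_fps_compose:
  "Abs_fps (\<lambda>i. ell i v) =
     Abs_fps (\<lambda>j. if j = 0 then 0 else (-1) ^ (j + 1) / (real j * v ^ j)) oo fps_ln 1"
proof (rule fps_ext)
  fix i
  have "Abs_fps (\<lambda>m. if m = 0 then 0 else (-1) ^ (m + 1) / real m) = fps_ln 1"
    by (rule fps_ext) (auto simp: fps_ln_nth intro!: arg_cong2[where f = "(/)"] simp: minus_one_power_iff)
  then show "fps_nth (Abs_fps (\<lambda>i. ell i v)) i = fps_nth (Abs_fps (\<lambda>j. if j = 0 then 0 else (-1) ^ (j + 1) / (real j * v ^ j)) oo fps_ln 1) i"
    unfolding fps_nth_Abs_fps ell_def bell_hat_def fps_compose_nth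
    by (simp only: sum.atLeast_Suc_atMost[of 0]) (simp add: mult.commute)
qed

text \<open>The formal version of the chain rule: the derivative of
  \<open>ln (1 + ln (1 + x) / v)\<close> is \<open>1 / ((1 + x) * (v + ln (1 + x)))\<close>.
  Clearing the denominator lets the identity be evaluated through products alone.\<close>

lemma fps_deriv_ell:
  assumes "v \<noteq> 0"
  shows "fps_deriv (Abs_fps (\<lambda>i. ell i v)) * ((1 + fps_X) * (fps_const v + fps_ln 1)) = 1"
proof -
  define P where "P = Abs_fps (\<lambda>j. if j = 0 then 0 else (-1) ^ (j + 1) / (real j * v ^ j))"
  \<comment> \<open>\<open>fps_deriv P\<close> is the alternating geometric series of
    \<open>1 / (v + X)\<close>.\<close>
  have P: "fps_deriv P * (fps_const v + fps_X) = 1"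
  proof (rule fps_ext)
    fix i show "fps_nth (fps_deriv P * (fps_const v + fps_X)) i = fps_nth 1 i"
      using assms by (cases i) (auto simp: P_def distrib_left simp del: of_nat_Suc)
  qed
  have "(fps_deriv P oo fps_ln 1) * (fps_const v + fps_ln 1) = 1"
    using arg_cong[OF P, of "\<lambda>F. F oo fps_ln 1"]
    by (simp add: fps_compose_mult_distrib fps_compose_add_distrib)
  moreover have "fps_deriv (fps_ln 1) * (1 + fps_X) = (1 :: real fps)"
    by (simp add: fps_ln_deriv inverse_mult_eq_1)
  ultimately have "((fps_deriv P oo fps_ln 1) * (fps_const v + fps_ln 1)) *
      (fps_deriv (fps_ln 1) * (1 + fps_X)) = 1" by simp
  then show ?thesis
    unfolding ell_fps_compose P_def[symmetric] by (simp add: fps_compose_deriv mult_ac)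
qed

lemma fps_conv_radius_ell: "v \<ge> 1 \<Longrightarrow> fps_conv_radius (Abs_fps (\<lambda>i. ell i v)) \<ge> ereal (1 / 4)"
  using fps_conv_radius_geI_geometric[of "Abs_fps (\<lambda>i. ell i v)" "1 / v" 4] ell_bound[of v]
  by simp

lemma one_plus_ln_div_pos:
  fixes x v :: real
  assumes "v \<ge> 1" "\<bar>x\<bar> < 1 / 4"
  shows "1 + ln (1 + x) / v > 0"
proof -
  have "\<bar>ln (1 + x) - x\<bar> \<le> 2 * x\<^sup>2"
    using assms by (intro abs_ln_one_plus_x_minus_x_bound) auto
  also have "2 * x\<^sup>2 \<le> 1 / 2"
    using power_mono[of "\<bar>x\<bar>" "1 / 4" 2] assms by (simp add: power2_eq_square)
  finally have "ln (1 + x) > - 1" using assms by linarith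
  then have "ln (1 + x) > - v" using assms by linarith
  then show ?thesis using assms by (simp add: field_simps)
qed

lemma eval_fps_ell:
  assumes "v \<ge> 1" "\<bar>x\<bar> < 1 / 4"
  shows "eval_fps (Abs_fps (\<lambda>i. ell i v)) x = ln (1 + ln (1 + x) / v)"
proof (rule eval_fps_eqI_deriv[where r = "1 / 4"])
  define F where "F = Abs_fps (\<lambda>i. ell i v)"
  fix x :: real assume x: "\<bar>x\<bar> < 1 / 4"
  have cr: "ereal (norm x) < fps_conv_radius (fps_deriv F)"
    using x fps_conv_radius_ell[OF assms(1)] fps_conv_radius_deriv[of F]
    unfolding F_def[symmetric]
    by (auto intro: less_le_trans[of _ "ereal (1 / 4)"])
  have cr2: "ereal (norm x) < fps_conv_radius (1 + fps_X :: real fps)"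
    by (rule less_le_trans[OF _ fps_conv_radius_add]) auto
  have cr3: "ereal (norm x) < fps_conv_radius (fps_ln 1 :: real fps)"
    using x fps_conv_radius_ln_1 by (auto intro: less_le_trans[of _ 1])
  have cr4: "ereal (norm x) < fps_conv_radius (fps_const v + fps_ln 1 :: real fps)"
    by (rule less_le_trans[OF _ fps_conv_radius_add]) (use cr3 in auto)
  have cr5: "ereal (norm x) < fps_conv_radius ((1 + fps_X) * (fps_const v + fps_ln 1) :: real fps)"
    by (rule less_le_trans[OF _ fps_conv_radius_mult]) (use cr2 cr4 in auto)
  have *: "eval_fps (fps_deriv F) x * ((1 + x) * (v + ln (1 + x))) = 1"
    using arg_cong[OF fps_deriv_ell[of v], of "\<lambda>F. eval_fps F x"] cr cr2 cr3 cr4 cr5 x assms(1)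
    by (simp add: eval_fps_mult eval_fps_add eval_fps_ln_1 F_def)
  have pos: "1 + ln (1 + x) / v > 0"
    using one_plus_ln_div_pos assms(1) x by blast
  have nz: "(1 + x) * (v + ln (1 + x)) \<noteq> 0" using * by auto
  have "((\<lambda>x. ln (1 + ln (1 + x) / v)) has_real_derivative
      (1 / (1 + x) / v) / (1 + ln (1 + x) / v)) (at x)"
    using x assms(1) pos by (auto intro!: derivative_eq_intros)
  also have "(1 / (1 + x) / v) / (1 + ln (1 + x) / v) = 1 / ((1 + x) * (v + ln (1 + x)))"
    using assms(1) nz pos by (simp add: divide_simps)
  also have "\<dots> = eval_fps (fps_deriv F) x"
    using * nz by (simp add: field_simps)
  finally show "((\<lambda>x. ln (1 + ln (1 + x) / v)) has_real_derivative
      eval_fps (fps_deriv (Abs_fps (\<lambda>i. ell i v))) x) (at x)"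
    unfolding F_def .
qed (use assms fps_conv_radius_ell in \<open>auto simp: ell_def\<close>)

lemma ell_1: "ell (Suc 0) v = 1 / v"
  by (simp add: ell_def bell_hat_def)

lemma ell_2: "v \<noteq> 0 \<Longrightarrow> ell 2 v = - (v + 1) / (2 * v\<^sup>2)"
  by (simp add: ell_def bell_hat_def numeral_2_eq_2 fps_mult_nth sum.atLeast_Suc_atMost field_simps)

lemma fps_conv_radius_ell_tail: "v \<ge> 1 \<Longrightarrow> fps_conv_radius (ell_tail v) \<ge> ereal (1 / 8)"
  using fps_conv_radius_geI_geometric[of "ell_tail v" "16 / v" 8] ell_tail_power_bound[of v 1]
  by simp

lemma ln_one_plus_ln_expansion:
  assumes "v \<ge> 1" "\<bar>x\<bar> < 1 / 8"
  shows "ln (1 + ln (1 + x) / v) =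
    x / v - (v + 1) / (2 * v\<^sup>2) * x\<^sup>2 + x\<^sup>2 * eval_fps (ell_tail v) x"
proof -
  have eq: "Abs_fps (\<lambda>i. ell i v) = fps_const (1 / v) * fps_X +
      fps_const (- (v + 1) / (2 * v\<^sup>2)) * fps_X ^ 2 + fps_X ^ 2 * ell_tail v" (is "_ = ?A + ?B + ?C")
  proof (rule fps_ext)
    fix i :: nat
    consider "i = 0" | "i = Suc 0" | "i = 2" | m where "i = m + 3"
      by (metis One_nat_def Suc_1 add.commute le_add_diff_inverse not_less_eq_eq numeral_3_eq_3 le_antisym le0)
    then show "fps_nth (Abs_fps (\<lambda>i. ell i v)) i = fps_nth (?A + ?B + ?C) i"
    proof cases
      case 4
      then show ?thesis
        by (simp add: fps_X_power_mult_nth ell_tail_def numeral_3_eq_3)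
    qed (use assms in \<open>auto simp: ell_def[of 0] ell_1 ell_2 fps_X_power_mult_nth ell_tail_def\<close>)
  qed
  have C: "ereal (norm x) < fps_conv_radius (ell_tail v)"
    using fps_conv_radius_ell_tail[OF assms(1)] assms(2) by (auto intro: less_le_trans[of _ "ereal (1 / 8)"])
  have A: "ereal (norm x) < fps_conv_radius ?A" "ereal (norm x) < fps_conv_radius ?B"
      "ereal (norm x) < fps_conv_radius ?C"
    by (rule less_le_trans[OF _ fps_conv_radius_mult], use C in simp)+
  have AB: "ereal (norm x) < fps_conv_radius (?A + ?B)"
    by (rule less_le_trans[OF _ fps_conv_radius_add]) (use A in simp)
  have "ln (1 + ln (1 + x) / v) = eval_fps (?A + ?B + ?C) x"
    using eval_fps_ell[of v x] assms unfolding eq by simp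
  also have "\<dots> = eval_fps ?A x + eval_fps ?B x + eval_fps ?C x"
    using A AB by (simp add: eval_fps_add)
  also have "\<dots> = x / v - (v + 1) / (2 * v\<^sup>2) * x\<^sup>2 + x\<^sup>2 * eval_fps (ell_tail v) x"
    using C by (simp add: eval_fps_mult diff_divide_distrib add_divide_distrib algebra_simps)
  finally show ?thesis .
qed

lemma ell_tail_power_remainder:
  assumes "v \<ge> 1" "\<bar>x\<bar> \<le> 1 / 16"
  shows "\<bar>eval_fps (ell_tail v) x ^ j - (\<Sum>i<k. fps_nth (ell_tail v ^ j) i * x ^ i)\<bar>
    \<le> 2 * (16 / v) ^ j * (8 * \<bar>x\<bar>) ^ k"
proof -
  have "ereal (norm x) < fps_conv_radius (ell_tail v)"
    using fps_conv_radius_ell_tail[OF assms(1)] assms(2) by (auto intro: less_le_trans[of _ "ereal (1 / 8)"])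
  then show ?thesis
    using eval_fps_remainder[of "ell_tail v ^ j" "(16 / v) ^ j" 8 x k] ell_tail_power_bound[OF assms(1)] assms(2)
    by (simp add: eval_fps_power)
qed

lemma divide_fact_le: "c \<ge> 0 \<Longrightarrow> c / fact j \<le> (c :: real)"
  using mult_left_mono[OF fact_ge_1[of j, where 'a = real], of c] by (simp add: divide_simps)


section \<open>Local expansion of the exponential factor and of its product with the quotient of
  \<open>f\<close>\<close>

text \<open>The coefficient of \<open>x ^ i\<close> in \<open>exp (w * ell_tail v)\<close> with
  \<open>w\<close> held fixed; powers \<open>j > i\<close> contribute nothing because
  \<open>ell_tail v\<close> has no constant term. Later \<open>w\<close> is
  \<open>n * x\<^sup>2\<close>.\<close>

definition phase_coeff :: "real \<Rightarrow> real \<Rightarrow> nat \<Rightarrow> real" where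
  "phase_coeff v w i = (\<Sum>j\<le>i. w ^ j / fact j * fps_nth (ell_tail v ^ j) i)"

text \<open>Each \<open>w ^ j\<close> meets a factor \<open>(16 / v) ^ j\<close>, so only
  \<open>w / v\<close> matters. The base is \<open>1 + w / v\<close> so that exponents
  \<open>j <= i\<close> can be raised to \<open>i\<close>; 128 is 16 times 8.\<close>

lemma phase_coeff_bound:
  assumes "v \<ge> 1" "w \<ge> 0"
  shows "\<bar>phase_coeff v w i\<bar> \<le> real (i + 1) * 128 ^ i * (1 + w / v) ^ i"
proof -
  have "\<bar>w ^ j / fact j * fps_nth (ell_tail v ^ j) i\<bar> \<le> 128 ^ i * (1 + w / v) ^ i" if "j \<le> i" for j
  proof -
    have "w ^ j / fact j \<le> w ^ j"
      using assms by (simp add: divide_fact_le)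
    then have "\<bar>w ^ j / fact j * fps_nth (ell_tail v ^ j) i\<bar> \<le> w ^ j * ((16 / v) ^ j * 8 ^ i)"
      unfolding abs_mult using assms ell_tail_power_bound[OF assms(1), of j i]
      by (intro mult_mono) auto
    also have "\<dots> = 16 ^ j * (w / v) ^ j * 8 ^ i"
      using assms by (simp add: power_divide field_simps)
    also have "\<dots> \<le> 16 ^ i * (1 + w / v) ^ i * 8 ^ i"
    proof (intro mult_mono)
      have "(w / v) ^ j \<le> (1 + w / v) ^ j"
        using assms by (intro power_mono) auto
      also have "\<dots> \<le> (1 + w / v) ^ i"
        using assms that by (intro power_increasing) auto
      finally show "(w / v) ^ j \<le> (1 + w / v) ^ i" .
    qed (use that assms in auto)
    also have "\<dots> = 128 ^ i * (1 + w / v) ^ i"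
      by (simp add: mult.commute mult.left_commute flip: power_mult_distrib)
    finally show ?thesis .
  qed
  then have "\<bar>phase_coeff v w i\<bar> \<le> (\<Sum>j\<le>i. 128 ^ i * (1 + w / v) ^ i)"
    unfolding phase_coeff_def by (intro order_trans[OF sum_abs] sum_mono) auto
  then show ?thesis by simp
qed

lemma exp_Taylor_remainder_bound:
  fixes z :: real
  shows "\<bar>exp z - (\<Sum>j<k. z ^ j / fact j)\<bar> \<le> exp \<bar>z\<bar> * \<bar>z\<bar> ^ k"
proof -
  obtain t where t: "\<bar>t\<bar> \<le> \<bar>z\<bar>" "exp z = (\<Sum>j<k. z ^ j / fact j) + exp t / fact k * z ^ k"
    using Maclaurin_exp_le[of z k] by blast
  have "exp t / fact k \<le> exp t"
    by (simp add: divide_fact_le)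
  also have "exp t \<le> exp \<bar>z\<bar>" using t by auto
  finally have "exp t / fact k * \<bar>z\<bar> ^ k \<le> exp \<bar>z\<bar> * \<bar>z\<bar> ^ k"
    by (intro mult_right_mono) auto
  then show ?thesis using t(2) by (simp add: abs_mult power_abs)
qed

text \<open>Two truncations at the same order: the exponential series at \<open>j < k\<close>, then
  each power of the tail series at \<open>x ^ k\<close>. The first is legitimate because the tail
  series is \<open>O (\<bar>x\<bar> / v)\<close>, so that its \<open>k\<close>-th power already
  supplies \<open>\<bar>x\<bar> ^ k\<close>; the hypothesis \<open>w * \<bar>x\<bar> \<le> v\<close>
  makes the exponent bounded.\<close>

lemma exp_phase_expansion:
  assumes "v \<ge> 1" "\<bar>x\<bar> \<le> 1 / 16" "w \<ge> 0" "w * \<bar>x\<bar> \<le> v"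
  shows "\<bar>exp (w * eval_fps (ell_tail v) x) - (\<Sum>i<k. phase_coeff v w i * x ^ i)\<bar>
    \<le> (exp 256 * 256 ^ k + 2 * real k * 128 ^ k) * (\<bar>x\<bar> ^ k * (1 + w / v) ^ k)"
proof -
  define q where "q = eval_fps (ell_tail v) x"
  define B where "B j i = fps_nth (ell_tail v ^ j) i" for j i
  have wv: "0 \<le> w / v" using assms by simp
  \<comment> \<open>The remainder bound at \<open>j = k = 1\<close>, where the subtracted sum is the
    zero constant term; 256 is 2 times 16 times 8.\<close>
  have "\<bar>q\<bar> \<le> 256 * \<bar>x\<bar> / v"
    using ell_tail_power_remainder[OF assms(1,2), of 1 1] by (simp add: q_def ell_tail_def)
  then have z: "\<bar>w * q\<bar> \<le> 256 * (w / v * \<bar>x\<bar>)"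
    using mult_left_mono[of "\<bar>q\<bar>" "256 * \<bar>x\<bar> / v" w] assms by (simp add: abs_mult mult_ac)
  have z256: "\<bar>w * q\<bar> \<le> 256"
  proof (rule order_trans[OF z])
    have "w * \<bar>x\<bar> / v \<le> 1" using assms by (simp add: divide_le_eq)
    then show "256 * (w / v * \<bar>x\<bar>) \<le> 256" by simp
  qed
  have "\<bar>exp (w * q) - (\<Sum>j<k. (w * q) ^ j / fact j)\<bar> \<le> exp 256 * (256 * (w / v * \<bar>x\<bar>)) ^ k"
    by (rule order_trans[OF exp_Taylor_remainder_bound]) (intro mult_mono power_mono, use z z256 in auto)
  also have "\<dots> = exp 256 * 256 ^ k * (\<bar>x\<bar> ^ k * (w / v) ^ k)"
    by (simp only: power_mult_distrib mult_ac)
  also have "\<dots> \<le> exp 256 * 256 ^ k * (\<bar>x\<bar> ^ k * (1 + w / v) ^ k)"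
    using wv by (intro mult_left_mono power_mono) auto
  finally have 1: "\<bar>exp (w * q) - (\<Sum>j<k. (w * q) ^ j / fact j)\<bar> \<le> \<dots>" .
  have swap: "(\<Sum>i<k. phase_coeff v w i * x ^ i) = (\<Sum>j<k. w ^ j / fact j * (\<Sum>i<k. B j i * x ^ i))"
  proof -
    have "(\<Sum>i<k. phase_coeff v w i * x ^ i) = (\<Sum>i<k. \<Sum>j<k. w ^ j / fact j * B j i * x ^ i)"
    proof (rule sum.cong[OF refl])
      fix i assume "i \<in> {..<k}"
      then have "phase_coeff v w i = (\<Sum>j<k. w ^ j / fact j * B j i)"
        unfolding phase_coeff_def B_def
        by (intro sum.mono_neutral_left) (auto simp: ell_tail_power_eq_0)
      then show "phase_coeff v w i * x ^ i = (\<Sum>j<k. w ^ j / fact j * B j i * x ^ i)"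
        by (simp add: sum_distrib_right)
    qed
    also have "\<dots> = (\<Sum>j<k. \<Sum>i<k. w ^ j / fact j * B j i * x ^ i)"
      by (rule sum.swap)
    finally show ?thesis by (simp add: sum_distrib_left mult_ac)
  qed
  have "\<bar>(\<Sum>j<k. (w * q) ^ j / fact j) - (\<Sum>i<k. phase_coeff v w i * x ^ i)\<bar>
      = \<bar>\<Sum>j<k. w ^ j / fact j * (q ^ j - (\<Sum>i<k. B j i * x ^ i))\<bar>"
    unfolding swap by (simp add: sum_subtractf power_mult_distrib right_diff_distrib)
  also have "\<dots> \<le> (\<Sum>j<k. 2 * 128 ^ k * (\<bar>x\<bar> ^ k * (1 + w / v) ^ k))"
  proof (rule order_trans[OF sum_abs], rule sum_mono)
    fix j assume "j \<in> {..<k}"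
    then have j: "j \<le> k" by simp
    have "w ^ j / fact j \<le> w ^ j"
      using assms by (simp add: divide_fact_le)
    then have "\<bar>w ^ j / fact j * (q ^ j - (\<Sum>i<k. B j i * x ^ i))\<bar>
        \<le> w ^ j * (2 * (16 / v) ^ j * (8 * \<bar>x\<bar>) ^ k)"
      unfolding abs_mult q_def B_def using assms
      by (intro mult_mono ell_tail_power_remainder) auto
    also have "\<dots> = 2 * 8 ^ k * \<bar>x\<bar> ^ k * (16 ^ j * (w / v) ^ j)"
      using assms by (simp add: power_divide power_mult_distrib field_simps)
    also have "\<dots> \<le> 2 * 8 ^ k * \<bar>x\<bar> ^ k * (16 ^ k * (1 + w / v) ^ k)"
    proof (intro mult_left_mono mult_mono)
      have "(w / v) ^ j \<le> (1 + w / v) ^ j"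
        using wv by (intro power_mono) auto
      also have "\<dots> \<le> (1 + w / v) ^ k"
        using wv j by (intro power_increasing) auto
      finally show "(w / v) ^ j \<le> (1 + w / v) ^ k" .
    qed (use wv j in auto)
    also have "\<dots> = 2 * (8 ^ k * 16 ^ k) * (\<bar>x\<bar> ^ k * (1 + w / v) ^ k)"
      by (simp only: mult_ac)
    also have "(8 ^ k * 16 ^ k :: real) = 128 ^ k"
      by (simp flip: power_mult_distrib)
    finally show "\<bar>w ^ j / fact j * (q ^ j - (\<Sum>i<k. B j i * x ^ i))\<bar>
        \<le> 2 * 128 ^ k * (\<bar>x\<bar> ^ k * (1 + w / v) ^ k)" .
  qed
  also have "\<dots> = 2 * real k * 128 ^ k * (\<bar>x\<bar> ^ k * (1 + w / v) ^ k)" by simp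
  finally show ?thesis using 1 unfolding q_def[symmetric] distrib_right by linarith
qed

text \<open>The product of the two expansions cut at total degree \<open>k\<close>: the sum for the
  quotient of \<open>f\<close> stops at \<open>k - i\<close>, so that no term of degree
  \<open>k\<close> or more in \<open>x\<close> appears (with \<open>w\<close> counted as degree
  0).\<close>

definition local_expansion :: "real \<Rightarrow> (nat \<Rightarrow> real) \<Rightarrow> nat \<Rightarrow> real \<Rightarrow> real \<Rightarrow> real" where
  "local_expansion v \<phi> k w x = (\<Sum>i<k. phase_coeff v w i * x ^ i * (\<Sum>m<k - i. \<phi> m * x ^ m))"

text \<open>The first summand pays for truncating the exponential, with \<open>\<kappa> 0\<close>
  bounding the quotient of \<open>f\<close>; the second pays for truncating that quotient at order
  \<open>k - i\<close> behind the \<open>i\<close>-th phase term.\<close>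

definition expansion_const :: "(nat \<Rightarrow> real) \<Rightarrow> nat \<Rightarrow> real" where
  "expansion_const \<kappa> k = (exp 256 * 256 ^ k + 2 * real k * 128 ^ k) * \<kappa> 0 +
     (\<Sum>i<k. real (i + 1) * 128 ^ i * \<kappa> (k - i))"

text \<open>With \<open>e\<close> the exponential, \<open>P i\<close> its terms and
  \<open>G i\<close> the partial sums of \<open>g\<close>, the error is
  \<open>(e - \<Sum>P i) * g + \<Sum>P i * (g - G i)\<close>. The case \<open>l = 0\<close> of the
  hypothesis on \<open>g\<close> bounds \<open>g\<close> itself.\<close>

lemma local_expansion_remainder:
  assumes "v \<ge> 1" "\<bar>x\<bar> \<le> 1 / 16" "w \<ge> 0" "w * \<bar>x\<bar> \<le> v" "\<rho> \<ge> 1"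
    and g: "\<And>l. \<bar>g - (\<Sum>m<l. \<phi> m * x ^ m)\<bar> \<le> \<kappa> l * (\<rho> * \<bar>x\<bar>) ^ l"
    and \<kappa>: "\<And>l. \<kappa> l \<ge> 0"
  shows "\<bar>exp (w * eval_fps (ell_tail v) x) * g - local_expansion v \<phi> k w x\<bar>
    \<le> expansion_const \<kappa> k * ((\<rho> * \<bar>x\<bar>) ^ k * (1 + w / v) ^ k)"
proof -
  define c where "c = exp 256 * 256 ^ k + 2 * real k * (128 ^ k :: real)"
  define X where "X = (\<rho> * \<bar>x\<bar>) ^ k * (1 + w / v) ^ k"
  define G where "G i = (\<Sum>m<k - i. \<phi> m * x ^ m)" for i
  define P where "P i = phase_coeff v w i * x ^ i" for i
  define e where "e = exp (w * eval_fps (ell_tail v) x)"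
  have wv: "0 \<le> w / v" using assms by simp
  have xk: "\<bar>x\<bar> ^ l \<le> (\<rho> * \<bar>x\<bar>) ^ l" for l
    using assms by (intro power_mono) (auto intro: mult_right_mono[of 1 \<rho>, simplified])
  have c0: "c \<ge> 0" by (simp add: c_def)
  have "\<bar>(e - (\<Sum>i<k. P i)) * g\<bar> \<le> (c * X) * \<kappa> 0"
    unfolding abs_mult
  proof (intro mult_mono)
    have "\<bar>e - (\<Sum>i<k. P i)\<bar> \<le> c * (\<bar>x\<bar> ^ k * (1 + w / v) ^ k)"
      unfolding e_def P_def c_def using assms by (intro exp_phase_expansion)
    also have "\<dots> \<le> c * X"
      unfolding X_def using xk wv c0 by (intro mult_left_mono mult_right_mono) auto
    finally show "\<bar>e - (\<Sum>i<k. P i)\<bar> \<le> c * X" .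
  qed (use g[of 0] c0 wv assms in \<open>auto simp: X_def\<close>)
  moreover have "\<bar>\<Sum>i<k. P i * (g - G i)\<bar> \<le> (\<Sum>i<k. real (i + 1) * 128 ^ i * \<kappa> (k - i) * X)"
  proof (rule order_trans[OF sum_abs], rule sum_mono)
    fix i assume "i \<in> {..<k}"
    then have i: "i < k" by simp
    have "\<bar>P i * (g - G i)\<bar> \<le> (real (i + 1) * 128 ^ i * (1 + w / v) ^ i * \<bar>x\<bar> ^ i) *
        (\<kappa> (k - i) * (\<rho> * \<bar>x\<bar>) ^ (k - i))"
      unfolding abs_mult P_def G_def power_abs
      using assms by (intro mult_mono g phase_coeff_bound) auto
    also have "\<dots> \<le> (real (i + 1) * 128 ^ i * (1 + w / v) ^ k * (\<rho> * \<bar>x\<bar>) ^ i) *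
        (\<kappa> (k - i) * (\<rho> * \<bar>x\<bar>) ^ (k - i))"
      using assms wv i \<kappa> xk
      by (intro mult_right_mono mult_mono mult_left_mono power_increasing) auto
    also have "\<dots> = real (i + 1) * 128 ^ i * \<kappa> (k - i) *
        (((\<rho> * \<bar>x\<bar>) ^ i * (\<rho> * \<bar>x\<bar>) ^ (k - i)) * (1 + w / v) ^ k)"
      by (simp only: mult_ac)
    also have "(\<rho> * \<bar>x\<bar>) ^ i * (\<rho> * \<bar>x\<bar>) ^ (k - i) = (\<rho> * \<bar>x\<bar>) ^ k"
      using i by (simp flip: power_add)
    finally show "\<bar>P i * (g - G i)\<bar> \<le> real (i + 1) * 128 ^ i * \<kappa> (k - i) * X"
      unfolding X_def .
  qed
  moreover have "e * g - local_expansion v \<phi> k w x = (e - (\<Sum>i<k. P i)) * g + (\<Sum>i<k. P i * (g - G i))"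
    unfolding local_expansion_def P_def[symmetric] G_def[symmetric]
    by (simp add: algebra_simps sum_subtractf sum_distrib_left)
  ultimately have "\<bar>e * g - local_expansion v \<phi> k w x\<bar>
      \<le> (c * X) * \<kappa> 0 + (\<Sum>i<k. real (i + 1) * 128 ^ i * \<kappa> (k - i) * X)"
    by linarith
  also have "\<dots> = expansion_const \<kappa> k * X"
    unfolding expansion_const_def c_def distrib_right sum_distrib_right by (simp add: mult_ac)
  finally show ?thesis unfolding e_def X_def .
qed

definition growth_const :: "(nat \<Rightarrow> real) \<Rightarrow> nat \<Rightarrow> real" where
  "growth_const \<mu> k = (\<Sum>i<k. real (i + 1) * 128 ^ i * (\<Sum>m<k - i. \<mu> m))"

text \<open>Needed outside the central range: the polynomial is integrated over the whole line, and
  its polynomial growth there must be controlled before the Gaussian absorbs it.\<close>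

lemma local_expansion_bound:
  assumes "v \<ge> 1" "w \<ge> 0" "\<rho> \<ge> 1" and \<phi>: "\<And>m. \<bar>\<phi> m\<bar> \<le> \<mu> m * \<rho> ^ m"
  shows "\<bar>local_expansion v \<phi> k w x\<bar> \<le> growth_const \<mu> k * (\<rho> ^ k * (1 + w / v) ^ k * (1 + \<bar>x\<bar>) ^ k)"
proof -
  have wv: "0 \<le> w / v" using assms by simp
  have \<mu>: "\<mu> m \<ge> 0" for m
  proof -
    have "0 \<le> \<mu> m * \<rho> ^ m" using \<phi>[of m] by linarith
    moreover have "\<rho> ^ m > 0" using assms(3) by simp
    ultimately show ?thesis by (simp add: zero_le_mult_iff)
  qed
  have "\<bar>phase_coeff v w i * x ^ i * (\<Sum>m<k - i. \<phi> m * x ^ m)\<bar> \<le>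
      real (i + 1) * 128 ^ i * (\<Sum>m<k - i. \<mu> m) * (\<rho> ^ k * (1 + w / v) ^ k * (1 + \<bar>x\<bar>) ^ k)"
    if i: "i < k" for i
  proof -
    have pc: "\<bar>phase_coeff v w i\<bar> \<le> real (i + 1) * 128 ^ i * (1 + w / v) ^ k"
      using i wv by (intro order_trans[OF phase_coeff_bound[OF assms(1,2)]] mult_left_mono power_increasing) auto
    have x: "\<bar>x\<bar> ^ m \<le> (1 + \<bar>x\<bar>) ^ m" for m by (intro power_mono) auto
    have "\<bar>\<Sum>m<k - i. \<phi> m * x ^ m\<bar> \<le> (\<Sum>m<k - i. \<mu> m * \<rho> ^ k * (1 + \<bar>x\<bar>) ^ (k - i))"
    proof (rule order_trans[OF sum_abs], rule sum_mono)
      fix m assume "m \<in> {..<k - i}"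
      then have m: "m \<le> k - i" "m \<le> k" by auto
      have "\<bar>\<phi> m * x ^ m\<bar> \<le> (\<mu> m * \<rho> ^ m) * (1 + \<bar>x\<bar>) ^ m"
        unfolding abs_mult power_abs using \<phi>[of m] x[of m] by (intro mult_mono) auto
      also have "\<dots> \<le> (\<mu> m * \<rho> ^ k) * (1 + \<bar>x\<bar>) ^ (k - i)"
        using m \<mu> assms(3) by (intro mult_mono mult_left_mono power_increasing) auto
      finally show "\<bar>\<phi> m * x ^ m\<bar> \<le> \<mu> m * \<rho> ^ k * (1 + \<bar>x\<bar>) ^ (k - i)" .
    qed
    then have "\<bar>phase_coeff v w i * x ^ i * (\<Sum>m<k - i. \<phi> m * x ^ m)\<bar> \<le>
        (real (i + 1) * 128 ^ i * (1 + w / v) ^ k * (1 + \<bar>x\<bar>) ^ i) *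
        (\<Sum>m<k - i. \<mu> m * \<rho> ^ k * (1 + \<bar>x\<bar>) ^ (k - i))"
      unfolding abs_mult power_abs using pc x wv by (intro mult_mono) auto
    also have "\<dots> = real (i + 1) * 128 ^ i * (\<Sum>m<k - i. \<mu> m) *
        (\<rho> ^ k * (1 + w / v) ^ k * ((1 + \<bar>x\<bar>) ^ i * (1 + \<bar>x\<bar>) ^ (k - i)))"
      unfolding sum_distrib_right[symmetric] by (simp only: mult_ac)
    also have "(1 + \<bar>x\<bar>) ^ i * (1 + \<bar>x\<bar>) ^ (k - i) = (1 + \<bar>x\<bar>) ^ k"
      using i by (simp flip: power_add)
    finally show ?thesis .
  qed
  then show ?thesis
    unfolding local_expansion_def growth_const_def sum_distrib_right
    by (intro order_trans[OF sum_abs] sum_mono) auto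
qed

section \<open>Gaussian moments and the coefficients \<open>a_r\<close>\<close>

lemma gaussian_moment:
  "has_bochner_integral lborel (\<lambda>y :: real. exp (- y\<^sup>2 / 2) * y ^ k)
     (if even k then sqrt (2 * pi) * real_of_int (double_fact (int k - 1)) else 0)"
proof -
  have eq: "exp (- y\<^sup>2 / 2) * y ^ k = sqrt (2 * pi) * (std_normal_density y * y ^ k)" for y :: real
    by (simp add: std_normal_density_def)
  show ?thesis
  proof (cases "even k")
    case True
    then obtain m where "k = 2 * m" by blast
    then show ?thesis
      unfolding eq using has_bochner_integral_mult_right[OF std_normal_moment_even[of m], of "sqrt (2 * pi)"]
      by (simp add: double_fact_odd)
  next
    case False
    then obtain m where "k = 2 * m + 1" by (auto elim: oddE)
    then show ?thesis
      unfolding eq using has_bochner_integral_mult_right[OF std_normal_moment_odd[of m], of "sqrt (2 * pi)"]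
      by simp
  qed
qed

lemma sum_triangle_diagonals:
  fixes h :: "nat \<Rightarrow> nat \<Rightarrow> 'a :: comm_monoid_add"
  shows "(\<Sum>i<k. \<Sum>m<k - i. h i m) = (\<Sum>t<k. \<Sum>i\<le>t. h i (t - i))"
proof -
  have "(\<Sum>i<k. \<Sum>m<k - i. h i m) = (\<Sum>(i, m)\<in>{(i, m). i + m < k}. h i m)"
    by (subst sum.Sigma) (auto intro!: sum.cong)
  then show ?thesis by (simp add: sum.triangle_reindex)
qed

lemma sum_triangle_swap:
  fixes h :: "nat \<Rightarrow> nat \<Rightarrow> 'a :: comm_monoid_add"
  shows "(\<Sum>i\<le>n. \<Sum>j\<le>i. h i j) = (\<Sum>j=0..n. \<Sum>i=j..n. h i j)"
proof -
  have "(\<Sum>i\<le>n. \<Sum>j\<le>i. h i j) = (\<Sum>i\<le>n. \<Sum>j\<in>{j\<in>{0..n}. j \<le> i}. h i j)"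
    by (intro sum.cong) auto
  also have "\<dots> = (\<Sum>j=0..n. \<Sum>i\<in>{i\<in>{..n}. j \<le> i}. h i j)"
    by (rule sum.swap_restrict) auto
  also have "\<dots> = (\<Sum>j=0..n. \<Sum>i=j..n. h i j)"
    by (intro sum.cong) auto
  finally show ?thesis .
qed

lemma sum_odd_vanish:
  fixes h :: "nat \<Rightarrow> 'a :: comm_monoid_add"
  assumes "\<And>r. h (2 * r + 1) = 0"
  shows "(\<Sum>t<2 * R. h t) = (\<Sum>r<R. h (2 * r))"
  using assms by (induction R) auto

text \<open>Grouped by the degree \<open>t\<close> in \<open>x\<close>, a term carries
  \<open>n ^ j * s ^ (2 * j + t) * y ^ (2 * j + t)\<close>. Odd \<open>t\<close> integrate to 0. For
  \<open>t = 2 * r\<close> the relation \<open>s\<^sup>2 = v\<^sup>2 / (v + 1) / n\<close> cancels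
  \<open>n ^ j\<close> and leaves \<open>(v\<^sup>2 / (v + 1)) ^ (j + r) / n ^ r\<close>, while the
  moment of order \<open>2 * j + 2 * r\<close> is the double factorial in
  \<open>a_coeff\<close>.\<close>

lemma gaussian_integral_local_expansion:
  assumes "v > 0" "n > 0" and s: "s = v / sqrt ((v + 1) * n)"
  shows "has_bochner_integral lborel
    (\<lambda>y. exp (- y\<^sup>2 / 2) * local_expansion v (\<lambda>m. fm m v) (2 * R) (n * (s * y)\<^sup>2) (s * y))
    (sqrt (2 * pi) * (\<Sum>r<R. a_coeff fm r v / n ^ r))"
proof -
  define B where "B j i = fps_nth (ell_tail v ^ j) i" for j i
  define c where "c t i j = n ^ j / fact j * B j i * fm (t - i) v * s ^ (2 * j + t)" for t i j
  define M where "M k = (if even k then sqrt (2 * pi) * real_of_int (double_fact (int k - 1)) else 0)" for k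
  have expand: "local_expansion v (\<lambda>m. fm m v) (2 * R) (n * (s * y)\<^sup>2) (s * y)
      = (\<Sum>t<2 * R. \<Sum>i\<le>t. \<Sum>j\<le>i. c t i j * y ^ (2 * j + t))" for y
  proof -
    have pw: "(n * (s * y)\<^sup>2) ^ j = n ^ j * s ^ (2 * j) * y ^ (2 * j)" for j
      by (simp only: power_mult_distrib power_mult mult.assoc)
    have "local_expansion v (\<lambda>m. fm m v) (2 * R) (n * (s * y)\<^sup>2) (s * y)
        = (\<Sum>t<2 * R. \<Sum>i\<le>t. phase_coeff v (n * (s * y)\<^sup>2) i * (s * y) ^ i *
             (fm (t - i) v * (s * y) ^ (t - i)))"
      unfolding local_expansion_def sum_distrib_left by (rule sum_triangle_diagonals)
    also have "\<dots> = (\<Sum>t<2 * R. \<Sum>i\<le>t. \<Sum>j\<le>i. c t i j * y ^ (2 * j + t))"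
    proof (intro sum.cong refl)
      fix t i :: nat assume "i \<in> {..t}"
      then have "(s * y) ^ t = (s * y) ^ i * (s * y) ^ (t - i)"
        by (simp flip: power_add)
      then have "phase_coeff v (n * (s * y)\<^sup>2) i * (s * y) ^ i * (fm (t - i) v * (s * y) ^ (t - i))
          = phase_coeff v (n * (s * y)\<^sup>2) i * (fm (t - i) v * (s * y) ^ t)"
        by simp
      also have "\<dots> = (\<Sum>j\<le>i. c t i j * y ^ (2 * j + t))"
        unfolding phase_coeff_def sum_distrib_right
        by (intro sum.cong refl, unfold pw) (simp only: c_def B_def power_mult_distrib power_add times_divide_eq_left times_divide_eq_right mult_ac)
      finally show "phase_coeff v (n * (s * y)\<^sup>2) i * (s * y) ^ i * (fm (t - i) v * (s * y) ^ (t - i))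
          = (\<Sum>j\<le>i. c t i j * y ^ (2 * j + t))" .
    qed
    finally show ?thesis .
  qed
  have "has_bochner_integral lborel
      (\<lambda>y. \<Sum>t<2 * R. \<Sum>i\<le>t. \<Sum>j\<le>i. c t i j * (exp (- y\<^sup>2 / 2) * y ^ (2 * j + t)))
      (\<Sum>t<2 * R. \<Sum>i\<le>t. \<Sum>j\<le>i. c t i j * M (2 * j + t))"
    unfolding M_def
    by (intro has_bochner_integral_sum has_bochner_integral_mult_right gaussian_moment)
  also have "(\<lambda>y. \<Sum>t<2 * R. \<Sum>i\<le>t. \<Sum>j\<le>i. c t i j * (exp (- y\<^sup>2 / 2) * y ^ (2 * j + t)))
      = (\<lambda>y. exp (- y\<^sup>2 / 2) * local_expansion v (\<lambda>m. fm m v) (2 * R) (n * (s * y)\<^sup>2) (s * y))"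
    unfolding expand sum_distrib_left by (simp add: mult_ac)
  also have "(\<Sum>t<2 * R. \<Sum>i\<le>t. \<Sum>j\<le>i. c t i j * M (2 * j + t))
      = (\<Sum>r<R. \<Sum>i\<le>2 * r. \<Sum>j\<le>i. c (2 * r) i j * M (2 * j + 2 * r))"
    by (rule sum_odd_vanish) (simp add: M_def)
  also have "\<dots> = (\<Sum>r<R. sqrt (2 * pi) * (a_coeff fm r v / n ^ r))"
  proof (rule sum.cong[OF refl])
    fix r
    have s2: "s\<^sup>2 = v\<^sup>2 / (v + 1) / n"
      using assms by (simp add: power_divide)
    have sp: "n ^ j * s ^ (2 * j + 2 * r) = (v\<^sup>2 / (v + 1)) ^ (j + r) / n ^ r" for j
    proof -
      have "s ^ (2 * j + 2 * r) = (s\<^sup>2) ^ (j + r)" by (simp only: power_mult[symmetric] distrib_left)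
      also have "\<dots> = (v\<^sup>2 / (v + 1)) ^ (j + r) / (n ^ j * n ^ r)"
        unfolding s2 power_divide[of _ n] power_add[of n] ..
      finally show ?thesis using assms by simp
    qed
    have M: "M (2 * j + 2 * r) = sqrt (2 * pi) * real_of_int (double_fact (2 * int j + 2 * int r - 1))" for j
      by (simp add: M_def)
    have c: "c (2 * r) i j * M (2 * j + 2 * r) = sqrt (2 * pi) *
        (real_of_int (double_fact (2 * int j + 2 * int r - 1)) / fact j * (v\<^sup>2 / (v + 1)) ^ (j + r) *
          (B j i * fm (2 * r - i) v) / n ^ r)" for i j
    proof -
      have "c (2 * r) i j * M (2 * j + 2 * r) = sqrt (2 * pi) *
        (real_of_int (double_fact (2 * int j + 2 * int r - 1)) / fact j *
          (B j i * fm (2 * r - i) v)) * (n ^ j * s ^ (2 * j + 2 * r))"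
        unfolding c_def M by (simp add: mult_ac)
      then show ?thesis unfolding sp by (simp add: mult_ac)
    qed
    show "(\<Sum>i\<le>2 * r. \<Sum>j\<le>i. c (2 * r) i j * M (2 * j + 2 * r)) = sqrt (2 * pi) * (a_coeff fm r v / n ^ r)"
      unfolding sum_triangle_swap c a_coeff_def bell_hat_ell_tail B_def
      by (simp add: sum_distrib_left sum_divide_distrib)
  qed
  finally show ?thesis by (simp add: sum_distrib_left)
qed

text \<open>Of \<open>(v\<^sup>2 / (v + 1)) ^ (j + r) \<le> v ^ (j + r)\<close>, the part
  \<open>v ^ j\<close> is cancelled by \<open>(16 / v) ^ j\<close> from the Bell polynomials. What
  remains is \<open>v ^ r\<close>, times at most \<open>v powr (2 * r * lam)\<close> from the
  coefficient functions.\<close>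

lemma a_coeff_bound:
  assumes "v \<ge> 1" "lam \<ge> 0" and fm: "\<And>m. \<bar>fm m v\<bar> \<le> M m * v powr (lam * real m)"
  shows "\<bar>a_coeff fm r v\<bar> \<le> (\<Sum>j=0..2*r. \<bar>of_int (double_fact (2 * int j + 2 * int r - 1)) / fact j\<bar> *
      (\<Sum>i=j..2*r. 16 ^ j * 8 ^ i * M (2*r - i))) * v powr (real r * (1 + 2 * lam))"
proof -
  define d where "d j = real_of_int (double_fact (2 * int j + 2 * int r - 1)) / fact j" for j
  define p where "p = v powr (real r * (1 + 2 * lam))"
  have M: "M m \<ge> 0" for m
  proof -
    have "0 \<le> M m * v powr (lam * real m)" using fm[of m] by linarith
    moreover have "v powr (lam * real m) > 0" using assms(1) by simp
    ultimately show ?thesis by (simp add: zero_le_mult_iff)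
  qed
  have summand: "\<bar>(v\<^sup>2 / (v + 1)) ^ (j + r) * (fps_nth (ell_tail v ^ j) i * fm (2*r - i) v)\<bar>
      \<le> 16 ^ j * 8 ^ i * M (2*r - i) * p" for i j
  proof -
    have "(v\<^sup>2 / (v + 1)) ^ (j + r) \<le> v ^ (j + r)"
    proof (rule power_mono)
      show "v\<^sup>2 / (v + 1) \<le> v"
        using assms by (simp add: divide_le_eq power2_eq_square algebra_simps)
    qed (use assms in auto)
    moreover have "\<bar>fm (2*r - i) v\<bar> \<le> M (2*r - i) * v powr (lam * (2 * real r))"
      by (rule order_trans[OF fm], intro mult_left_mono M powr_mono) (use assms in auto)
    ultimately have "\<bar>(v\<^sup>2 / (v + 1)) ^ (j + r) * (fps_nth (ell_tail v ^ j) i * fm (2*r - i) v)\<bar>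
      \<le> v ^ (j + r) * (((16 / v) ^ j * 8 ^ i) * (M (2*r - i) * v powr (lam * (2 * real r))))"
      unfolding abs_mult using ell_tail_power_bound[OF assms(1), of j i] assms(1)
      by (intro mult_mono) auto
    also have "\<dots> = 16 ^ j * 8 ^ i * M (2*r - i) * (v ^ r * v powr (lam * (2 * real r)))"
      using assms(1) by (simp add: power_divide power_add)
    also have "v ^ r * v powr (lam * (2 * real r)) = p"
    proof -
      have "v ^ r * v powr (lam * (2 * real r)) = v powr (real r + lam * (2 * real r))"
        using assms(1) by (simp add: powr_add powr_realpow)
      also have "real r + lam * (2 * real r) = real r * (1 + 2 * lam)"
        by (simp add: algebra_simps)
      finally show ?thesis unfolding p_def .
    qed
    finally show ?thesis .
  qed
  have eq: "a_coeff fm r v = (\<Sum>j=0..2*r. d j * (\<Sum>i=j..2*r.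
      (v\<^sup>2 / (v + 1)) ^ (j + r) * (fps_nth (ell_tail v ^ j) i * fm (2*r - i) v)))"
    unfolding a_coeff_def bell_hat_ell_tail d_def[symmetric] by (simp only: mult.assoc sum_distrib_left)
  have "\<bar>a_coeff fm r v\<bar> \<le> (\<Sum>j=0..2*r. \<bar>d j\<bar> * (\<Sum>i=j..2*r. 16 ^ j * 8 ^ i * M (2*r - i) * p))"
    unfolding eq
  proof (rule order_trans[OF sum_abs], rule sum_mono)
    fix j
    have "\<bar>\<Sum>i=j..2*r. (v\<^sup>2 / (v + 1)) ^ (j + r) * (fps_nth (ell_tail v ^ j) i * fm (2*r - i) v)\<bar>
        \<le> (\<Sum>i=j..2*r. 16 ^ j * 8 ^ i * M (2*r - i) * p)"
      by (rule order_trans[OF sum_abs]) (intro sum_mono summand)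
    then show "\<bar>d j * (\<Sum>i=j..2*r. (v\<^sup>2 / (v + 1)) ^ (j + r) * (fps_nth (ell_tail v ^ j) i * fm (2*r - i) v))\<bar>
        \<le> \<bar>d j\<bar> * (\<Sum>i=j..2*r. 16 ^ j * 8 ^ i * M (2*r - i) * p)"
      unfolding abs_mult[of "d j"] by (intro mult_left_mono) auto
  qed
  also have "\<dots> = (\<Sum>j=0..2*r. \<bar>d j\<bar> * (\<Sum>i=j..2*r. 16 ^ j * 8 ^ i * M (2*r - i))) * p"
    by (simp add: sum_distrib_right mult.assoc)
  finally show ?thesis unfolding d_def p_def .
qed

section \<open>Elementary estimates for the Gaussian weight and the logarithm\<close>

lemma integrable_exp_neg_abs: "integrable lborel (\<lambda>y :: real. exp (- \<bar>y\<bar>))"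
proof -
  have 1: "integrable lborel (\<lambda>y :: real. exp (- y) * indicator {0..} y)"
  proof (rule integrableI_nonneg)
    show "(\<integral>\<^sup>+ y. ennreal (exp (- y) * indicator {0..} y) \<partial>lborel) < \<infinity>"
      using nn_intergal_power_times_exp_Ici[of 0] by (simp add: ennreal_mult'' ennreal_indicator)
  qed auto
  have 2: "integrable lborel (\<lambda>y :: real. exp (- (0 + (- 1) * y)) * indicator {0..} (0 + (- 1) * y))"
    by (rule lborel_integrable_real_affine[OF 1]) simp
  show ?thesis
    by (rule Bochner_Integration.integrable_bound[OF Bochner_Integration.integrable_add[OF 1 2]])
       (auto split: split_indicator)
qed

text \<open>The rate 2 is chosen so that one factor \<open>exp (- \<bar>y\<bar>)\<close> ensures
  integrability and the other becomes a small constant for large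
  \<open>\<bar>y\<bar>\<close>.\<close>

lemma power_times_gaussian_le:
  fixes y :: real
  shows "(1 + \<bar>y\<bar>) ^ p * exp (- y\<^sup>2 / 2) \<le> fact p * exp 6 * exp (- 2 * \<bar>y\<bar>)"
proof -
  have "(1 + \<bar>y\<bar>) ^ p / fact p \<le> exp (1 + \<bar>y\<bar>)"
  proof -
    have "(\<Sum>k\<in>{p}. inverse (fact k) * (1 + \<bar>y\<bar>) ^ k) \<le> (\<Sum>k. inverse (fact k) * (1 + \<bar>y\<bar>) ^ k)"
      by (rule sum_le_suminf) (auto simp: summable_exp)
    then show ?thesis by (simp add: exp_def divide_inverse mult.commute)
  qed
  then have "(1 + \<bar>y\<bar>) ^ p \<le> fact p * exp (1 + \<bar>y\<bar>)"
    by (simp add: divide_le_eq mult.commute)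
  then have "(1 + \<bar>y\<bar>) ^ p * exp (- y\<^sup>2 / 2) \<le> fact p * exp (1 + \<bar>y\<bar>) * exp (- y\<^sup>2 / 2)"
    by (rule mult_right_mono) simp
  also have "\<dots> = fact p * exp (1 + \<bar>y\<bar> - y\<^sup>2 / 2)"
    by (simp flip: exp_add)
  also have "\<dots> \<le> fact p * exp (6 - 2 * \<bar>y\<bar>)"
  proof -
    \<comment> \<open>Completing the square gives the constant 11/2, rounded up to 6.\<close>
    have "0 \<le> (\<bar>y\<bar> - 3)\<^sup>2" by simp
    then have "1 + \<bar>y\<bar> - y\<^sup>2 / 2 \<le> 6 - 2 * \<bar>y\<bar>"
      by (simp add: power2_eq_square algebra_simps flip: abs_mult)
    then show ?thesis by simp
  qed
  also have "\<dots> = fact p * exp 6 * exp (- 2 * \<bar>y\<bar>)"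
    by (simp add: mult.assoc flip: exp_add)
  finally show ?thesis .
qed

lemma ln_one_plus_le_nonneg:
  fixes x :: real
  assumes "x \<ge> 0"
  shows "ln (1 + x) \<le> x - x\<^sup>2 / (2 * (1 + x))"
proof -
  define h where "h z = ln (1 + z) - z + z\<^sup>2 / (2 * (1 + z))" for z :: real
  have "h x \<le> h 0"
  proof (rule DERIV_nonpos_imp_nonincreasing[OF assms])
    fix z :: real assume z: "0 \<le> z" "z \<le> x"
    have "(h has_real_derivative
        1 / (1 + z) - 1 + (2 * z * (2 * (1 + z)) - z\<^sup>2 * 2) / (2 * (1 + z) * (2 * (1 + z)))) (at z)"
      unfolding h_def using z by (auto intro!: derivative_eq_intros)
    also have "1 / (1 + z) - 1 + (2 * z * (2 * (1 + z)) - z\<^sup>2 * 2) / (2 * (1 + z) * (2 * (1 + z)))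
        = - z\<^sup>2 / (2 * (1 + z)\<^sup>2)"
      using z by (simp add: divide_simps power2_eq_square) (simp add: algebra_simps)
    finally have "(h has_real_derivative - z\<^sup>2 / (2 * (1 + z)\<^sup>2)) (at z)" .
    moreover have "- z\<^sup>2 / (2 * (1 + z)\<^sup>2) \<le> 0" using z by simp
    ultimately show "\<exists>y. (h has_real_derivative y) (at z) \<and> y \<le> 0" by blast
  qed
  then show ?thesis by (simp add: h_def)
qed

lemma ln_one_plus_le_nonpos:
  fixes x :: real
  assumes "- 1 < x" "x \<le> 0"
  shows "ln (1 + x) \<le> x - x\<^sup>2 / 2"
proof -
  define h where "h z = ln (1 + z) - z + z\<^sup>2 / 2" for z :: real
  have "h x \<le> h 0"
  proof (rule DERIV_nonneg_imp_nondecreasing[OF assms(2)])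
    fix z :: real assume z: "x \<le> z" "z \<le> 0"
    have "(h has_real_derivative z\<^sup>2 / (1 + z)) (at z)"
      unfolding h_def using z assms
      by (auto intro!: derivative_eq_intros simp: divide_simps power2_eq_square) (simp add: algebra_simps)
    moreover have "z\<^sup>2 / (1 + z) \<ge> 0" using z assms by simp
    ultimately show "\<exists>y. (h has_real_derivative y) (at z) \<and> y \<ge> 0" by blast
  qed
  then show ?thesis by (simp add: h_def)
qed

text \<open>The decay of \<open>ln (1 + x) - x\<close> is quadratic near 0 but only linear at
  infinity. Outside \<open>\<bar>x\<bar> < \<delta>\<close> both are covered by one linear bound,
  which is the form the tail estimate can integrate.\<close>

lemma ln_one_plus_minus_le:
  fixes x \<delta> :: real
  assumes "- 1 < x" "0 < \<delta>" "\<delta> \<le> 1" "\<delta> \<le> \<bar>x\<bar>"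
  shows "ln (1 + x) - x \<le> - (\<delta> * \<bar>x\<bar> / 4)"
proof (cases "x \<ge> 0")
  case True
  have "\<delta> * x * (1 + x) \<le> 2 * x\<^sup>2"
  proof -
    have "\<delta> * (1 + x) \<le> x + x"
    proof -
      have "\<delta> * x \<le> 1 * x" using assms True by (intro mult_right_mono) auto
      moreover have "\<delta> \<le> x" using assms True by simp
      ultimately show ?thesis unfolding distrib_left by linarith
    qed
    from mult_right_mono[OF this, of x] show ?thesis
      using True by (simp add: power2_eq_square algebra_simps)
  qed
  then have "\<delta> * x / 4 \<le> x\<^sup>2 / (2 * (1 + x))"
    using True by (simp add: field_simps)
  moreover have "\<bar>x\<bar> = x" using True by simp
  ultimately show ?thesis using ln_one_plus_le_nonneg[OF True] by linarith
next
  case False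
  have "\<delta> * \<bar>x\<bar> \<le> \<bar>x\<bar> * \<bar>x\<bar>"
    using assms by (intro mult_right_mono) auto
  then have "\<delta> * \<bar>x\<bar> \<le> x\<^sup>2" by (simp add: power2_eq_square)
  moreover have "0 \<le> \<delta> * \<bar>x\<bar>" using assms by simp
  ultimately show ?thesis using ln_one_plus_le_nonpos[of x] False assms(1) by linarith
qed

section \<open>Consequences of suitability\<close>

lemma powr_mult_of_nat: "v > 0 \<Longrightarrow> v powr (lam * real k) = (v powr lam) ^ k" for v lam :: real
  by (simp add: powr_realpow flip: powr_powr)

lemma suitability_expansion:
  assumes "suitability_constants f lam fm K M" "v \<ge> 1" "\<bar>x\<bar> \<le> 1 / (2 * v powr lam)"
  shows "\<bar>f (exp v * (x + 1)) / f (exp v) - (\<Sum>m<k. fm m v * x ^ m)\<bar> \<le> K k * (v powr lam * \<bar>x\<bar>) ^ k"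
proof -
  have "(v powr lam * \<bar>x\<bar>) ^ k = v powr (lam * real k) * \<bar>x\<bar> ^ k"
    using assms(2) by (simp add: powr_mult_of_nat power_mult_distrib)
  then show ?thesis using assms unfolding suitability_constants_def by simp
qed

lemma suitability_coeff_bound:
  assumes "suitability_constants f lam fm K M" "v \<ge> 1"
  shows "\<bar>fm m v\<bar> \<le> M m * (v powr lam) ^ m"
proof -
  have "\<bar>fm m v\<bar> \<le> M m * v powr (lam * real m)"
    using assms unfolding suitability_constants_def by blast
  then show ?thesis using assms(2) by (simp add: powr_mult_of_nat)
qed

text \<open>Tested at \<open>v = 1\<close> and \<open>x = 1/2\<close>, the edge of the admissible
  range; at \<open>x = 0\<close> the bound carries no information when \<open>k > 0\<close>.\<close>

lemma suitability_const_nonneg: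
  assumes "suitability_constants f lam fm K M"
  shows "K k \<ge> 0"
proof -
  have "0 \<le> K k * (1 powr lam * \<bar>1 / 2\<bar>) ^ k"
    by (rule order_trans[OF abs_ge_zero suitability_expansion[OF assms]]) auto
  moreover have "0 < (1 powr lam * \<bar>1 / 2 :: real\<bar>) ^ k" by simp
  ultimately show ?thesis by (metis mult_neg_pos not_le)
qed

text \<open>The expansion of order 1 at \<open>x = 0\<close> has zero error.\<close>

lemma suitability_coeff_0:
  assumes "suitability_constants f lam fm K M" "v \<ge> 1" "f (exp v) > 0"
  shows "fm 0 v = 1"
  using suitability_expansion[OF assms(1,2), of 0 1] assms(3) by simp

text \<open>Iterating \<open>f (t * (1 - h)) \<le> K 0 * f t\<close> with \<open>h = 1 / (2 * u powr lam)\<close> brings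
  \<open>exp u\<close> down to the compact interval \<open>[1, e]\<close> in \<open>O (u powr (lam + 1))\<close> steps.\<close>

lemma suitable_lower_bound:
  assumes cont: "continuous_on {1..} f" and pos: "\<And>t. t \<ge> 1 \<Longrightarrow> 0 < f t"
    and sc: "suitability_constants f lam fm K M" and lam: "lam \<ge> 0"
  shows "\<exists>m>0. \<exists>c\<ge>0. \<forall>u\<ge>1. m * exp (- c * u powr (lam + 1)) \<le> f (exp u)"
proof -
  have "continuous_on {1..exp 1} f" by (rule continuous_on_subset[OF cont]) auto
  then obtain t0 where t0: "t0 \<in> {1..exp 1}" "\<And>t. t \<in> {1..exp 1} \<Longrightarrow> f t0 \<le> f t"
    using continuous_attains_inf[of "{1..exp 1}" f] by force
  define m where "m = f t0"
  have m: "m > 0" using t0 pos by (simp add: m_def)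
  have ratio: "f (exp v * (x + 1)) / f (exp v) \<le> K 0" if "v \<ge> 1" "\<bar>x\<bar> \<le> 1 / (2 * v powr lam)" for v x
    by (rule abs_le_D1) (use suitability_expansion[OF sc that, of 0] in simp)
  have K0: "K 0 \<ge> 1" using ratio[of 1 0] pos[of "exp 1"] by simp
  \<comment> \<open>\<open>k\<close> bounds the number of steps still to make. The step size is
    taken from the fixed top \<open>u\<close>, which is admissible at every lower \<open>v\<close>
    because \<open>1 / (2 * v powr lam)\<close> decreases in \<open>v\<close>.\<close>
  have step: "m / K 0 ^ k \<le> f (exp v)"
    if "u \<ge> 1" "0 \<le> v" "v \<le> u" "v \<le> 1 + real k / (2 * u powr lam)" for u v k
    using that
  proof (induction k arbitrary: v)
    case 0
    then show ?case using t0(2)[of "exp v"] by (simp add: m_def)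
  next
    case (Suc k)
    show ?case
    proof (cases "v \<le> 1")
      case True
      then have "m \<le> f (exp v)" using t0(2)[of "exp v"] Suc.prems by (simp add: m_def)
      moreover have "m / K 0 ^ Suc k \<le> m"
        using m one_le_power[OF K0, of "Suc k"] by (simp add: divide_le_eq del: power_Suc)
      ultimately show ?thesis by simp
    next
      case False
      define h where "h = 1 / (2 * u powr lam)"
      have up: "u powr lam \<ge> 1" using Suc.prems lam by (simp add: ge_one_powr_ge_zero)
      have h: "0 < h" "h \<le> 1 / 2" using up by (auto simp: h_def divide_simps)
      have hv: "h \<le> 1 / (2 * v powr lam)"
        unfolding h_def using False Suc.prems lam
        by (intro divide_left_mono mult_left_mono powr_mono2 mult_pos_pos) auto
      define v' where "v' = v + ln (1 - h)"
      have "ln (1 - h) \<le> - h" using ln_add_one_self_le_self2[of "- h"] h by simp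
      then have v'1: "v' \<le> v - h" by (simp add: v'_def)
      \<comment> \<open>One step lowers \<open>v > 1\<close> by less than 1, so the descent may pass
        below 1 but never below 0, where \<open>m\<close> no longer bounds \<open>f\<close>.\<close>
      have "ln (1 - h) \<ge> ln (1 / 2)" using h by simp
      moreover have "ln (1 / 2 :: real) \<ge> - 1"
        using ln_2_less_1 by (simp add: ln_div)
      ultimately have v'0: "0 \<le> v'" using False by (simp add: v'_def)
      have "v' \<le> 1 + real k / (2 * u powr lam)"
        using v'1 Suc.prems(4) by (simp add: h_def add_divide_distrib)
      with Suc.IH[of v'] Suc.prems v'0 v'1 h have "m / K 0 ^ k \<le> f (exp v')" by simp
      also have "exp v' = exp v * (- h + 1)" using h by (simp add: v'_def exp_add)
      also have "f (exp v * (- h + 1)) \<le> K 0 * f (exp v)"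
        using ratio[of v "- h"] False h hv pos[of "exp v"] by (simp add: divide_le_eq)
      finally have "m / K 0 ^ k \<le> K 0 * f (exp v)" .
      then show ?thesis using K0 by (simp add: field_simps)
    qed
  qed
  have "m * exp (- (3 * ln (K 0)) * u powr (lam + 1)) \<le> f (exp u)" if u: "u \<ge> 1" for u
  proof -
    have up: "u powr lam \<ge> 1" using u lam by (simp add: ge_one_powr_ge_zero)
    have up1: "u powr (lam + 1) = u powr lam * u" using u by (simp add: powr_add)
    have up2: "u powr (lam + 1) \<ge> 1" using u lam by (simp add: ge_one_powr_ge_zero)
    \<comment> \<open>Enough steps of length at least \<open>1 / (2 * u powr lam)\<close> to cover
      \<open>u\<close>; rounding up is absorbed in the factor 3 because
      \<open>u powr (lam + 1) \<ge> 1\<close>.\<close>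
    define k where "k = nat \<lceil>2 * u powr (lam + 1)\<rceil>"
    have k1: "2 * u powr (lam + 1) \<le> real k" unfolding k_def by (rule real_nat_ceiling_ge)
    have k2: "real k \<le> 3 * u powr (lam + 1)" using up2 unfolding k_def by linarith
    have "u \<le> real k / (2 * u powr lam)"
      by (subst pos_le_divide_eq) (use k1 up in \<open>auto simp: up1 mult_ac\<close>)
    then have "m / K 0 ^ k \<le> f (exp u)" using step[of u u k] u by simp
    moreover have "K 0 ^ k = exp (real k * ln (K 0))"
      using K0 by (simp add: exp_of_nat_mult)
    moreover have "real k * ln (K 0) \<le> 3 * ln (K 0) * u powr (lam + 1)"
      using mult_right_mono[OF k2, of "ln (K 0)"] K0 by (simp add: mult_ac)
    then have "m * exp (- (3 * ln (K 0)) * u powr (lam + 1)) \<le> m * exp (- (real k * ln (K 0)))"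
      using m by simp
    ultimately show ?thesis by (simp add: exp_minus divide_inverse)
  qed
  moreover have "3 * ln (K 0) \<ge> 0" using K0 by simp
  ultimately show ?thesis using m by blast
qed

section \<open>The saddle point at a fixed large \<open>u\<close>\<close>

text \<open>The degree \<open>6 * R\<close> is \<open>2 * R\<close> from the powers of
  \<open>x\<close> plus \<open>4 * R\<close> from the weight
  \<open>(1 + n * x\<^sup>2 / u) ^ (2 * R)\<close>, since
  \<open>n * x\<^sup>2 / u \<le> y\<^sup>2\<close>.\<close>

definition central_const :: "(nat \<Rightarrow> real) \<Rightarrow> nat \<Rightarrow> real" where
  "central_const K R = expansion_const K (2 * R) * (fact (6 * R) * exp 6)"

definition tail_const :: "(nat \<Rightarrow> real) \<Rightarrow> nat \<Rightarrow> real" where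
  "tail_const M R = growth_const M (2 * R) * (fact (6 * R) * exp 6)"

text \<open>Here \<open>u\<close> is the primary parameter and
  \<open>n = u * \<alpha> * exp u\<close>, so the Lambert equation holds by construction. The
  assumptions from \<open>u\<close> onwards express that \<open>u\<close> is large. For the cutoff
  \<open>Y\<close>: \<open>Y3\<close> bounds the phase beyond the quadratic term,
  \<open>Y\<rho>\<close> keeps \<open>x\<close> in the range of the expansion of \<open>f\<close>,
  \<open>Y \<ge> 16 * b\<close> absorbs the growth \<open>t powr b\<close>, and
  \<open>tail_f\<close>, \<open>tail_1\<close> make the tails of size
  \<open>1 / N ^ R\<close>.\<close>

locale saddle =
  fixes \<alpha> b lam A u Y :: real and f :: "real \<Rightarrow> real" and fm :: "nat \<Rightarrow> real \<Rightarrow> real"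
    and K M :: "nat \<Rightarrow> real" and R :: nat and N n s \<rho> :: real
  defines "N \<equiv> \<alpha> * exp u" and "n \<equiv> u * N" and "s \<equiv> u / sqrt ((u + 1) * n)" and "\<rho> \<equiv> u powr lam"
  assumes b: "b \<ge> 0" and lam: "lam \<ge> 0"
    and cont: "continuous_on {1..} f"
    and f_pos: "\<And>t. t \<ge> 1 \<Longrightarrow> 0 < f t" and f_le: "\<And>t. t \<ge> 1 \<Longrightarrow> f t \<le> A * t powr b"
    and sc: "suitability_constants f lam fm K M"
    and u: "u \<ge> 1" and N: "N \<ge> 1"
    and Y: "Y \<ge> 32" "Y \<ge> 16 * b" and Y3: "Y ^ 3 \<le> sqrt N" and Y\<rho>: "Y / sqrt N \<le> 1 / (2 * \<rho>)"
    and tail_f: "A * exp (u * b) / f (exp u) * exp (- Y) \<le> 1 / N ^ R"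
    and tail_1: "exp (- Y) \<le> 1 / N ^ R"
begin

lemma n_pos: "n > 0"
  using u N by (simp add: n_def)

lemma n_div_u: "n / u = N"
  using u by (simp add: n_def)

lemma rho_ge_1: "\<rho> \<ge> 1"
  using u lam by (simp add: \<rho>_def ge_one_powr_ge_zero)

lemma s_pos: "s > 0"
  using u n_pos by (simp add: s_def)

lemma s_sq: "s\<^sup>2 = u\<^sup>2 / ((u + 1) * n)"
  using u n_pos by (simp add: s_def power_divide)

lemma N_s_sq: "N * s\<^sup>2 = u / (u + 1)"
  using u N unfolding s_sq n_def by (simp add: power2_eq_square)

text \<open>The upper bound says that \<open>x\<close> has scale at most \<open>N^(-1/2)\<close>;
  the lower one guarantees decay in \<open>y\<close> in the tail.\<close>

lemma N_s_sq_bounds: "N * s\<^sup>2 \<le> 1" "N * s\<^sup>2 \<ge> 1 / 2"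
  using u unfolding N_s_sq by (simp_all add: divide_simps)

lemma s_sq_le: "s\<^sup>2 \<le> 1 / N"
  using N_s_sq_bounds(1) N by (simp add: le_divide_eq mult.commute)

lemma s_le: "s \<le> 1 / sqrt N"
  using real_le_rsqrt[OF s_sq_le] by (simp add: real_sqrt_divide)

lemma s_le_1: "s \<le> 1"
proof -
  have "1 / sqrt N \<le> 1" using N by simp
  then show ?thesis using s_le by linarith
qed

lemma abs_scaled_le: "\<bar>s * y\<bar> \<le> \<bar>y\<bar>"
  using mult_right_mono[OF s_le_1, of "\<bar>y\<bar>"] s_pos by (simp add: abs_mult)

lemma phase_weight_le: "n * (s * y)\<^sup>2 / u \<le> y\<^sup>2"
proof -
  have "n * (s * y)\<^sup>2 / u = (n / u) * s\<^sup>2 * y\<^sup>2"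
    by (simp add: power_mult_distrib)
  also have "\<dots> \<le> 1 * y\<^sup>2"
    unfolding n_div_u using N_s_sq_bounds by (intro mult_right_mono) auto
  finally show ?thesis by simp
qed

lemma f_exp_pos: "f (exp u) > 0"
  using f_pos u by simp

text \<open>The integrand in the variable \<open>y\<close>, divided by its value
  \<open>u powr n * exp (- N) * f (exp u)\<close> at the saddle point. The indicator carries the
  original domain, so that \<open>y\<close> ranges over the whole line.\<close>

definition kernel :: "real \<Rightarrow> real" where
  "kernel y = indicator {1..} (exp u * (1 + s * y)) *
     ((ln (exp u * (1 + s * y)) / u) powr n * exp (- (N * (s * y))) *
      (f (exp u * (1 + s * y)) / f (exp u)))"

definition expansion :: "real \<Rightarrow> real" where
  "expansion y = exp (- y\<^sup>2 / 2) * local_expansion u (\<lambda>m. fm m u) (2 * R) (n * (s * y)\<^sup>2) (s * y)"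

lemma I_int_eq_kernel:
  "I_int \<alpha> f n = u powr (n + 1) * f (exp u) * exp (u - n / u) / sqrt ((1 + u) * n) *
     integral\<^sup>L lborel kernel"
proof -
  define H where "H t = indicator {1..} t *\<^sub>R (ln t powr n * exp (- \<alpha> * t) * f t)" for t :: real
  have H: "H (exp u + exp u * s * y) = (u powr n * exp (- N) * f (exp u)) * kernel y" for y
  proof (cases "exp u * (1 + s * y) \<ge> 1")
    case True
    have t: "exp u + exp u * s * y = exp u * (1 + s * y)" by (simp add: algebra_simps)
    have "(ln (exp u * (1 + s * y)) / u) powr n = ln (exp u * (1 + s * y)) powr n / u powr n"
      using True u by (intro powr_divide)
    moreover have "exp (- \<alpha> * (exp u * (1 + s * y))) = exp (- N) * exp (- (N * (s * y)))"
      by (simp add: N_def algebra_simps flip: exp_add)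
    ultimately show ?thesis
      unfolding H_def kernel_def t using True u f_exp_pos by simp
  next
    case False
    then show ?thesis by (simp add: H_def kernel_def algebra_simps)
  qed
  have c: "exp u * s > 0" using s_pos by simp
  have "I_int \<alpha> f n = integral\<^sup>L lborel H"
    unfolding I_int_def set_lebesgue_integral_def H_def ..
  also have "\<dots> = \<bar>exp u * s\<bar> *\<^sub>R (\<integral>y. H (exp u + exp u * s * y) \<partial>lborel)"
    using s_pos by (intro lborel_integral_real_affine) simp
  also have "\<dots> = exp u * s * ((u powr n * exp (- N) * f (exp u)) * integral\<^sup>L lborel kernel)"
    unfolding H using c by simp
  also have "\<dots> = u powr (n + 1) * f (exp u) * exp (u - n / u) / sqrt ((1 + u) * n) * integral\<^sup>L lborel kernel"
    using u unfolding n_div_u s_def by (simp add: powr_add exp_diff exp_minus field_simps)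
  finally show ?thesis .
qed

lemma kernel_measurable: "kernel \<in> borel_measurable lborel"
proof -
  have "continuous_on {1..} (\<lambda>t. f t / f (exp u))"
    using f_exp_pos by (intro continuous_intros cont) auto
  then have "(\<lambda>t. indicator {1..} t *\<^sub>R (f t / f (exp u))) \<in> borel_measurable borel"
    by (intro borel_measurable_continuous_on_indicator) auto
  then have [measurable]: "(\<lambda>t. indicator {1..} t * (f t / f (exp u))) \<in> borel_measurable borel"
    by simp
  have "(\<lambda>y. (ln (exp u * (1 + s * y)) / u) powr n * exp (- (N * (s * y))) *
      (\<lambda>t. indicator {1..} t * (f t / f (exp u))) (exp u * (1 + s * y))) \<in> borel_measurable lborel"
    by measurable
  moreover have "kernel = (\<lambda>y. (ln (exp u * (1 + s * y)) / u) powr n * exp (- (N * (s * y))) *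
      (\<lambda>t. indicator {1..} t * (f t / f (exp u))) (exp u * (1 + s * y)))"
    by (rule ext) (simp add: kernel_def mult_ac)
  ultimately show ?thesis by simp
qed

text \<open>The linear phase term \<open>n / u * x = N * x\<close> cancels against
  \<open>exp (- (N * x))\<close>, and the quadratic one is \<open>- y\<^sup>2 / 2\<close> by the
  choice of \<open>s\<close>. The indicator is 1 since \<open>exp u \<ge> 2\<close>.\<close>

lemma kernel_eq_central:
  assumes x: "\<bar>s * y\<bar> < 1 / 8"
  shows "kernel y = exp (- y\<^sup>2 / 2) *
    (exp (n * (s * y)\<^sup>2 * eval_fps (ell_tail u) (s * y)) * (f (exp u * (s * y + 1)) / f (exp u)))"
proof -
  define x where "x = s * y"
  define q where "q = eval_fps (ell_tail u) x"
  have x8: "\<bar>x\<bar> < 1 / 8" using assms by (simp add: x_def)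
  have "1 \<le> exp u * (1 / 2)" using exp_ge_add_one_self[of u] u by linarith
  also have "\<dots> \<le> exp u * (1 + x)" using x8 by (intro mult_left_mono) auto
  finally have ind: "1 \<le> exp u * (1 + x)" .
  have pos: "1 + ln (1 + x) / u > 0" using x8 u by (intro one_plus_ln_div_pos) auto
  have "ln (exp u * (1 + x)) / u = 1 + ln (1 + x) / u"
    using x8 u by (simp add: ln_mult add_divide_distrib)
  then have "(ln (exp u * (1 + x)) / u) powr n = exp (n * ln (1 + ln (1 + x) / u))"
    using pos by (simp add: powr_def)
  also have "n * ln (1 + ln (1 + x) / u) = N * x - y\<^sup>2 / 2 + n * x\<^sup>2 * q"
  proof -
    have "n * ln (1 + ln (1 + x) / u) = n / u * x - n * ((u + 1) / (2 * u\<^sup>2) * x\<^sup>2) + n * x\<^sup>2 * q"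
      unfolding ln_one_plus_ln_expansion[OF u x8] q_def by (simp add: algebra_simps)
    moreover have "n * ((u + 1) / (2 * u\<^sup>2) * x\<^sup>2) = y\<^sup>2 / 2"
      unfolding x_def power_mult_distrib s_sq using u n_pos by simp
    ultimately show ?thesis by (simp add: n_div_u)
  qed
  finally have "(ln (exp u * (1 + x)) / u) powr n * exp (- (N * x)) = exp (- y\<^sup>2 / 2) * exp (n * x\<^sup>2 * q)"
    by (simp flip: exp_add)
  then show ?thesis
    using ind unfolding kernel_def x_def[symmetric] q_def[symmetric] by (simp add: add.commute)
qed



lemma weight_power_le: "(1 + n * (s * y)\<^sup>2 / u) ^ (2 * R) \<le> (1 + \<bar>y\<bar>) ^ (4 * R)"
proof -
  have "1 + n * (s * y)\<^sup>2 / u \<le> 1 + y\<^sup>2" using phase_weight_le by simp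
  also have "\<dots> \<le> (1 + \<bar>y\<bar>)\<^sup>2" by (simp add: power2_eq_square algebra_simps)
  finally have "(1 + n * (s * y)\<^sup>2 / u) ^ (2 * R) \<le> ((1 + \<bar>y\<bar>)\<^sup>2) ^ (2 * R)"
    using n_pos u by (intro power_mono) auto
  then show ?thesis by (simp flip: power_mult)
qed

lemma gaussian_weight_le:
  fixes y :: real
  shows "exp (- y\<^sup>2 / 2) * ((1 + \<bar>y\<bar>) ^ (4 * R) * (1 + \<bar>y\<bar>) ^ (2 * R)) \<le> fact (6 * R) * exp 6 * exp (- 2 * \<bar>y\<bar>)"
  using power_times_gaussian_le[of y "6 * R"] by (simp add: mult.commute flip: power_add)

lemma expansion_const_nonneg: "expansion_const K k \<ge> 0"
  unfolding expansion_const_def using suitability_const_nonneg[OF sc]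
  by (intro add_nonneg_nonneg mult_nonneg_nonneg sum_nonneg) auto

lemma growth_const_nonneg: "growth_const M k \<ge> 0"
proof -
  have "M m \<ge> 0" for m
  proof -
    have "0 \<le> M m * (1 powr lam) ^ m"
      by (rule order_trans[OF abs_ge_zero suitability_coeff_bound[OF sc]]) simp
    then show ?thesis by simp
  qed
  then show ?thesis
    unfolding growth_const_def by (intro mult_nonneg_nonneg sum_nonneg) auto
qed

lemma kernel_central_bound:
  assumes y: "\<bar>y\<bar> \<le> Y"
  shows "\<bar>kernel y - expansion y\<bar> \<le> central_const K R * (\<rho>\<^sup>2 / N) ^ R * exp (- \<bar>y\<bar>)"
proof -
  define x where "x = s * y"
  have xY: "\<bar>x\<bar> \<le> Y / sqrt N"
    using mult_mono[OF s_le y] s_pos N by (simp add: x_def abs_mult)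
  have x\<rho>: "\<bar>x\<bar> \<le> 1 / (2 * u powr lam)" using xY Y\<rho> unfolding \<rho>_def by linarith
  \<comment> \<open>\<open>Y3\<close> gives \<open>\<bar>x\<bar> \<le> 1 / Y\<^sup>2\<close>, which
    for \<open>Y \<ge> 32\<close> is far below the 1/16 needed for the tail series.\<close>
  have "Y / sqrt N \<le> Y / Y ^ 3"
    using Y Y3 N by (intro divide_left_mono mult_pos_pos) auto
  also have "Y / Y ^ 3 = 1 / Y\<^sup>2" using Y by (simp add: power2_eq_square power3_eq_cube)
  also have "\<dots> \<le> 1 / 32\<^sup>2" using Y by (intro divide_left_mono power_mono mult_pos_pos) auto
  also have "1 / 32\<^sup>2 \<le> (1 / 16 :: real)" by simp
  finally have x16: "\<bar>x\<bar> \<le> 1 / 16" using xY by linarith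
  have "n * x\<^sup>2 * \<bar>x\<bar> = u * (N * \<bar>x\<bar> ^ 3)"
    by (simp add: n_def power2_eq_square power3_eq_cube flip: abs_mult)
  also have "N * \<bar>x\<bar> ^ 3 \<le> 1"
  proof -
    have "N * \<bar>x\<bar> ^ 3 \<le> N * (Y / sqrt N) ^ 3"
      using xY N by (intro mult_left_mono power_mono) auto
    also have "\<dots> = Y ^ 3 / sqrt N"
    proof -
      have "sqrt N ^ 3 = N * sqrt N" using N by (simp add: power3_eq_cube)
      then show ?thesis using N by (simp add: power_divide)
    qed
    also have "\<dots> \<le> 1" using Y3 N by (simp add: divide_le_eq)
    finally show ?thesis .
  qed
  finally have w: "n * x\<^sup>2 * \<bar>x\<bar> \<le> u" using u by simp
  define g where "g = f (exp u * (x + 1)) / f (exp u)"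
  define L where "L = local_expansion u (\<lambda>m. fm m u) (2 * R) (n * x\<^sup>2) x"
  have "\<bar>exp (n * x\<^sup>2 * eval_fps (ell_tail u) x) * g - L\<bar>
      \<le> expansion_const K (2 * R) * ((\<rho> * \<bar>x\<bar>) ^ (2 * R) * (1 + n * x\<^sup>2 / u) ^ (2 * R))"
    unfolding L_def
  proof (rule local_expansion_remainder)
    show "\<bar>g - (\<Sum>m<l. fm m u * x ^ m)\<bar> \<le> K l * (\<rho> * \<bar>x\<bar>) ^ l" for l
      unfolding g_def \<rho>_def by (rule suitability_expansion[OF sc u x\<rho>])
  qed (use u x16 n_pos w rho_ge_1 suitability_const_nonneg[OF sc] in auto)
  also have "\<dots> \<le> expansion_const K (2 * R) * (((\<rho>\<^sup>2 / N) ^ R * (1 + \<bar>y\<bar>) ^ (2 * R)) * (1 + \<bar>y\<bar>) ^ (4 * R))"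
  proof (intro mult_left_mono mult_mono expansion_const_nonneg)
    have "(\<rho> * \<bar>x\<bar>) ^ (2 * R) = (\<rho>\<^sup>2 * s\<^sup>2) ^ R * \<bar>y\<bar> ^ (2 * R)"
      unfolding power_mult x_def by (simp add: power_mult_distrib)
    also have "\<dots> \<le> (\<rho>\<^sup>2 * (1 / N)) ^ R * (1 + \<bar>y\<bar>) ^ (2 * R)"
      using s_sq_le N by (intro mult_mono power_mono mult_left_mono) auto
    finally show "(\<rho> * \<bar>x\<bar>) ^ (2 * R) \<le> (\<rho>\<^sup>2 / N) ^ R * (1 + \<bar>y\<bar>) ^ (2 * R)" by simp
    show "(1 + n * x\<^sup>2 / u) ^ (2 * R) \<le> (1 + \<bar>y\<bar>) ^ (4 * R)"
      unfolding x_def by (rule weight_power_le)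
  qed (use N n_pos u in auto)
  finally have *: "\<bar>exp (n * x\<^sup>2 * eval_fps (ell_tail u) x) * g - L\<bar>
      \<le> expansion_const K (2 * R) * (((\<rho>\<^sup>2 / N) ^ R * (1 + \<bar>y\<bar>) ^ (2 * R)) * (1 + \<bar>y\<bar>) ^ (4 * R))" .
  have "kernel y - expansion y = exp (- y\<^sup>2 / 2) * (exp (n * x\<^sup>2 * eval_fps (ell_tail u) x) * g - L)"
    using kernel_eq_central[of y] x16 unfolding expansion_def L_def g_def x_def[symmetric]
    by (simp add: right_diff_distrib)
  then have "\<bar>kernel y - expansion y\<bar> = exp (- y\<^sup>2 / 2) * \<bar>exp (n * x\<^sup>2 * eval_fps (ell_tail u) x) * g - L\<bar>"
    by (simp add: abs_mult)
  also have "\<dots> \<le> exp (- y\<^sup>2 / 2) * (expansion_const K (2 * R) *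
      (((\<rho>\<^sup>2 / N) ^ R * (1 + \<bar>y\<bar>) ^ (2 * R)) * (1 + \<bar>y\<bar>) ^ (4 * R)))"
    using * by (intro mult_left_mono) auto
  also have "\<dots> = expansion_const K (2 * R) * (\<rho>\<^sup>2 / N) ^ R *
      (exp (- y\<^sup>2 / 2) * ((1 + \<bar>y\<bar>) ^ (4 * R) * (1 + \<bar>y\<bar>) ^ (2 * R)))"
    by (simp only: mult_ac)
  also have "\<dots> \<le> expansion_const K (2 * R) * (\<rho>\<^sup>2 / N) ^ R *
      (fact (6 * R) * exp 6 * exp (- \<bar>y\<bar>))"
  proof (rule mult_left_mono, rule order_trans[OF gaussian_weight_le])
    show "fact (6 * R) * exp 6 * exp (- 2 * \<bar>y\<bar>) \<le> fact (6 * R) * exp 6 * exp (- \<bar>y\<bar>)" by simp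
    show "0 \<le> expansion_const K (2 * R) * (\<rho>\<^sup>2 / N) ^ R"
      using N expansion_const_nonneg by simp
  qed
  also have "\<dots> = central_const K R * (\<rho>\<^sup>2 / N) ^ R * exp (- \<bar>y\<bar>)"
    unfolding central_const_def by (simp only: mult_ac)
  finally show ?thesis .
qed

text \<open>No series is available here. Instead \<open>ln z \<le> z - 1\<close> at
  \<open>z = ln t / u\<close> gives \<open>(ln t / u) powr n \<le> (1 + x) powr N\<close>, which
  replaces the iterated logarithm by a single one.\<close>

lemma kernel_tail_bound:
  assumes y: "\<bar>y\<bar> \<ge> Y"
  shows "\<bar>kernel y\<bar> \<le> (\<rho>\<^sup>2 / N) ^ R * exp (- \<bar>y\<bar>)"
proof (cases "exp u * (1 + s * y) \<ge> 1")
  case False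
  then show ?thesis using N by (simp add: kernel_def)
next
  case True
  define x where "x = s * y"
  define t where "t = exp u * (1 + x)"
  have t: "t \<ge> 1" using True by (simp add: t_def x_def)
  then have x1: "1 + x > 0" unfolding t_def by (metis exp_gt_zero less_le_trans zero_less_mult_pos zero_less_one)
  have lnt: "ln t = u + ln (1 + x)" using x1 by (simp add: t_def ln_mult)
  have yY: "Y \<le> \<bar>y\<bar>" "32 \<le> \<bar>y\<bar>" using y Y by auto
  have "(ln t / u) powr n \<le> exp (N * ln (1 + x))"
  \<comment> \<open>At the endpoint \<open>t = 1\<close> the logarithm of \<open>ln t / u\<close> is
    not usable, but \<open>0 powr n\<close> is 0.\<close>
  proof (cases "ln t = 0")
    case False
    then have p: "ln t / u > 0" using t u by simp
    have "ln (ln t / u) \<le> ln t / u - 1" using p by (rule ln_le_minus_one)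
    then have "n * ln (ln t / u) \<le> n * (ln t / u - 1)" using n_pos by simp
    also have "\<dots> = N * ln (1 + x)" using u by (simp add: lnt n_def field_simps)
    finally show ?thesis using p by (simp add: powr_def)
  qed simp
  moreover have "f t / f (exp u) \<le> A * exp (u * b) / f (exp u) * exp (b * ln (1 + x))"
  proof -
    have "f t \<le> A * t powr b" using f_le t by blast
    also have "t powr b = exp (u * b) * exp (b * ln (1 + x))"
      using t by (simp add: powr_def lnt distrib_left mult.commute flip: exp_add)
    finally show ?thesis using f_exp_pos by (simp add: divide_right_mono)
  qed
  ultimately have "(ln t / u) powr n * exp (- (N * x)) * (f t / f (exp u)) \<le>
      exp (N * ln (1 + x)) * exp (- (N * x)) * (A * exp (u * b) / f (exp u) * exp (b * ln (1 + x)))"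
    using f_pos[OF t] f_exp_pos by (intro mult_mono) auto
  also have "\<dots> = A * exp (u * b) / f (exp u) * exp (N * (ln (1 + x) - x) + b * ln (1 + x))"
    by (simp add: right_diff_distrib exp_add exp_diff exp_minus field_simps)
  also have "\<dots> \<le> A * exp (u * b) / f (exp u) * exp (- Y - \<bar>y\<bar>)"
  proof (intro mult_left_mono)
    \<comment> \<open>\<open>s * Y\<close> is the \<open>\<delta>\<close> of
      \<open>ln_one_plus_minus_le\<close>: \<open>\<bar>y\<bar> \<ge> Y\<close> means
      \<open>\<bar>x\<bar> \<ge> s * Y\<close>.\<close>
    have "s * Y \<le> 1"
    proof -
      have "Y \<le> Y ^ 3" using Y by (intro self_le_power) auto
      also note Y3
      finally have "1 / sqrt N * Y \<le> 1" using N by simp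
      moreover have "s * Y \<le> 1 / sqrt N * Y" using s_le Y by (intro mult_right_mono) auto
      ultimately show ?thesis by linarith
    qed
    then have "ln (1 + x) - x \<le> - (s * Y * \<bar>x\<bar> / 4)"
      using s_pos Y y x1
      by (intro ln_one_plus_minus_le) (auto simp: x_def abs_mult)
    then have "N * (ln (1 + x) - x) \<le> N * - (s * Y * \<bar>x\<bar> / 4)"
      using N by (intro mult_left_mono) auto
    also have "\<dots> = - (N * s\<^sup>2 * (Y * \<bar>y\<bar> / 4))"
      using s_pos by (simp add: x_def abs_mult power2_eq_square)
    also have "\<dots> \<le> - (1 / 2 * (Y * \<bar>y\<bar> / 4))"
      using N_s_sq_bounds Y by (intro le_imp_neg_le mult_right_mono) auto
    finally have 1: "N * (ln (1 + x) - x) \<le> - (Y * \<bar>y\<bar> / 8)" by simp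
    have "ln (1 + x) \<le> \<bar>y\<bar>"
    proof -
      have "ln (1 + x) \<le> x" using ln_add_one_self_le_self2[of x] x1 by simp
      also have "x \<le> \<bar>y\<bar>"
        using abs_scaled_le[of y] unfolding x_def by linarith
      finally show ?thesis .
    qed
    then have "b * ln (1 + x) \<le> b * \<bar>y\<bar>" using b by (intro mult_left_mono) auto
    moreover have "b * \<bar>y\<bar> \<le> Y / 16 * \<bar>y\<bar>" using Y by (intro mult_right_mono) auto
    ultimately have 2: "b * ln (1 + x) \<le> Y * \<bar>y\<bar> / 16" by simp
    \<comment> \<open>After the factor from \<open>t powr b\<close> has used half of
      \<open>Y * \<bar>y\<bar> / 8\<close>, the remaining \<open>Y * \<bar>y\<bar> / 16\<close>
      splits into two halves, one at least \<open>\<bar>y\<bar>\<close> and one at least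
      \<open>Y\<close>.\<close>
    have 3: "32 * \<bar>y\<bar> \<le> Y * \<bar>y\<bar>" using Y by (intro mult_right_mono) auto
    have 4: "Y * 32 \<le> Y * \<bar>y\<bar>" using Y yY by (intro mult_left_mono) auto
    show "exp (N * (ln (1 + x) - x) + b * ln (1 + x)) \<le> exp (- Y - \<bar>y\<bar>)"
      using 1 2 3 4 by simp
    have "0 \<le> A * exp u powr b" using f_le[of "exp u"] f_exp_pos u by simp
    then show "0 \<le> A * exp (u * b) / f (exp u)"
      using f_exp_pos by (simp add: powr_def zero_le_mult_iff)
  qed
  also have "\<dots> = A * exp (u * b) / f (exp u) * exp (- Y) * exp (- \<bar>y\<bar>)"
    by (simp add: exp_diff exp_minus divide_inverse)
  also have "\<dots> \<le> 1 / N ^ R * exp (- \<bar>y\<bar>)"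
    using tail_f by (intro mult_right_mono) auto
  also have "\<dots> \<le> (\<rho>\<^sup>2 / N) ^ R * exp (- \<bar>y\<bar>)"
    using N rho_ge_1 unfolding power_divide
    by (intro mult_right_mono divide_right_mono) auto
  finally have "(ln t / u) powr n * exp (- (N * x)) * (f t / f (exp u)) \<le> (\<rho>\<^sup>2 / N) ^ R * exp (- \<bar>y\<bar>)" .
  moreover have "kernel y = (ln t / u) powr n * exp (- (N * x)) * (f t / f (exp u))"
    using True by (simp add: kernel_def t_def x_def)
  moreover have "0 \<le> (ln t / u) powr n * exp (- (N * x)) * (f t / f (exp u))"
    using f_pos[OF t] f_exp_pos by simp
  ultimately show ?thesis by simp
qed

lemma expansion_tail_bound:
  assumes y: "\<bar>y\<bar> \<ge> Y"
  shows "\<bar>expansion y\<bar> \<le> tail_const M R * (\<rho>\<^sup>2 / N) ^ R * exp (- \<bar>y\<bar>)"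
proof -
  define x where "x = s * y"
  have "\<bar>local_expansion u (\<lambda>m. fm m u) (2 * R) (n * x\<^sup>2) x\<bar>
      \<le> growth_const M (2 * R) * (\<rho> ^ (2 * R) * (1 + n * x\<^sup>2 / u) ^ (2 * R) * (1 + \<bar>x\<bar>) ^ (2 * R))"
    by (rule local_expansion_bound)
       (use u n_pos rho_ge_1 suitability_coeff_bound[OF sc u] in \<open>auto simp: \<rho>_def\<close>)
  also have "\<dots> \<le> growth_const M (2 * R) * (\<rho> ^ (2 * R) * (1 + \<bar>y\<bar>) ^ (4 * R) * (1 + \<bar>y\<bar>) ^ (2 * R))"
  proof (intro mult_left_mono mult_mono growth_const_nonneg)
    show "(1 + n * x\<^sup>2 / u) ^ (2 * R) \<le> (1 + \<bar>y\<bar>) ^ (4 * R)"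
      unfolding x_def by (rule weight_power_le)
    show "(1 + \<bar>x\<bar>) ^ (2 * R) \<le> (1 + \<bar>y\<bar>) ^ (2 * R)"
      using abs_scaled_le[of y] unfolding x_def by (intro power_mono) auto
  qed (use rho_ge_1 in auto)
  finally have *: "\<bar>local_expansion u (\<lambda>m. fm m u) (2 * R) (n * x\<^sup>2) x\<bar>
      \<le> growth_const M (2 * R) * (\<rho> ^ (2 * R) * (1 + \<bar>y\<bar>) ^ (4 * R) * (1 + \<bar>y\<bar>) ^ (2 * R))" .
  have "\<bar>expansion y\<bar> \<le> exp (- y\<^sup>2 / 2) *
      (growth_const M (2 * R) * (\<rho> ^ (2 * R) * (1 + \<bar>y\<bar>) ^ (4 * R) * (1 + \<bar>y\<bar>) ^ (2 * R)))"
    unfolding expansion_def abs_mult x_def[symmetric] using * by simp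
  also have "\<dots> = growth_const M (2 * R) * \<rho> ^ (2 * R) *
      (exp (- y\<^sup>2 / 2) * ((1 + \<bar>y\<bar>) ^ (4 * R) * (1 + \<bar>y\<bar>) ^ (2 * R)))"
    by (simp only: mult_ac)
  also have "\<dots> \<le> growth_const M (2 * R) * \<rho> ^ (2 * R) * (fact (6 * R) * exp 6 * exp (- 2 * \<bar>y\<bar>))"
    using gaussian_weight_le growth_const_nonneg rho_ge_1 by (intro mult_left_mono) auto
  also have "\<dots> = tail_const M R * \<rho> ^ (2 * R) * exp (- 2 * \<bar>y\<bar>)"
    unfolding tail_const_def by (simp only: mult_ac)
  also have "\<dots> \<le> tail_const M R * \<rho> ^ (2 * R) * (1 / N ^ R * exp (- \<bar>y\<bar>))"
  proof (intro mult_left_mono)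
    have "exp (- 2 * \<bar>y\<bar>) \<le> exp (- Y) * exp (- \<bar>y\<bar>)"
      using y by (simp flip: exp_add)
    also have "\<dots> \<le> 1 / N ^ R * exp (- \<bar>y\<bar>)"
      using tail_1 by (intro mult_right_mono) auto
    finally show "exp (- 2 * \<bar>y\<bar>) \<le> 1 / N ^ R * exp (- \<bar>y\<bar>)" .
    show "0 \<le> tail_const M R * \<rho> ^ (2 * R)"
      using growth_const_nonneg rho_ge_1 by (simp add: tail_const_def)
  qed
  also have "\<dots> = tail_const M R * (\<rho>\<^sup>2 / N) ^ R * exp (- \<bar>y\<bar>)"
    by (simp add: power_divide power_mult)
  finally show ?thesis .
qed

lemma kernel_bound:
  "\<bar>kernel y - expansion y\<bar> \<le> (1 + central_const K R + tail_const M R) * (\<rho>\<^sup>2 / N) ^ R * exp (- \<bar>y\<bar>)"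
proof -
  define Z where "Z = (\<rho>\<^sup>2 / N) ^ R * exp (- \<bar>y\<bar>)"
  have Z: "Z \<ge> 0" using N by (simp add: Z_def)
  have c: "central_const K R \<ge> 0" "tail_const M R \<ge> 0"
    using expansion_const_nonneg growth_const_nonneg by (auto simp: central_const_def tail_const_def)
  have cZ: "central_const K R * Z \<ge> 0" "tail_const M R * Z \<ge> 0" using c Z by auto
  have "\<bar>kernel y - expansion y\<bar> \<le> Z + central_const K R * Z + tail_const M R * Z"
  proof (cases "\<bar>y\<bar> \<le> Y")
    case True
    then show ?thesis
      using kernel_central_bound[OF True] cZ Z by (simp add: Z_def mult.assoc)
  next
    case False
    then have "\<bar>kernel y\<bar> \<le> Z" "\<bar>expansion y\<bar> \<le> tail_const M R * Z"
      using kernel_tail_bound[of y] expansion_tail_bound[of y] by (auto simp: Z_def mult.assoc)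
    then show ?thesis using cZ by linarith
  qed
  then show ?thesis by (simp add: Z_def distrib_right mult.assoc)
qed

text \<open>The difference is dominated by a multiple of \<open>exp (- \<bar>y\<bar>)\<close>, hence
  integrable; adding the integrable \<open>expansion\<close> yields integrability of
  \<open>kernel\<close>, which linearity of the integral requires.\<close>

lemma integral_kernel:
  "\<bar>integral\<^sup>L lborel kernel - sqrt (2 * pi) * (\<Sum>r<R. a_coeff fm r u / n ^ r)\<bar>
    \<le> (1 + central_const K R + tail_const M R) * (\<integral>y. exp (- \<bar>y\<bar>) \<partial>lborel) * (\<rho>\<^sup>2 / N) ^ R"
proof -
  define c where "c = (1 + central_const K R + tail_const M R) * (\<rho>\<^sup>2 / N) ^ R"
  have e: "has_bochner_integral lborel expansion (sqrt (2 * pi) * (\<Sum>r<R. a_coeff fm r u / n ^ r))"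
    unfolding expansion_def using u n_pos s_def by (intro gaussian_integral_local_expansion) auto
  have ie: "integrable lborel expansion" using e by (rule integrable.intros)
  have bnd: "integrable lborel (\<lambda>y. c * exp (- \<bar>y\<bar>))"
    by (intro integrable_mult_right integrable_exp_neg_abs)
  have d: "integrable lborel (\<lambda>y. kernel y - expansion y)"
  proof (rule Bochner_Integration.integrable_bound[OF bnd])
    show "(\<lambda>y. kernel y - expansion y) \<in> borel_measurable lborel"
      using kernel_measurable borel_measurable_integrable[OF ie] by measurable
    show "AE y in lborel. norm (kernel y - expansion y) \<le> norm (c * exp (- \<bar>y\<bar>))"
      using kernel_bound unfolding c_def[symmetric]
      by (auto intro!: always_eventually order_trans[OF _ abs_ge_self])
  qed
  have "integrable lborel (\<lambda>y. (kernel y - expansion y) + expansion y)"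
    by (rule Bochner_Integration.integrable_add[OF d ie])
  then have ik: "integrable lborel kernel" by simp
  have "integral\<^sup>L lborel kernel - sqrt (2 * pi) * (\<Sum>r<R. a_coeff fm r u / n ^ r)
      = (\<integral>y. kernel y - expansion y \<partial>lborel)"
    using ik ie has_bochner_integral_integral_eq[OF e] by simp
  moreover have "\<bar>\<integral>y. kernel y - expansion y \<partial>lborel\<bar> \<le> (\<integral>y. c * exp (- \<bar>y\<bar>) \<partial>lborel)"
    using Bochner_Integration.integral_norm_bound_integral[OF d bnd] kernel_bound unfolding c_def[symmetric] by simp
  ultimately show ?thesis by (simp add: c_def mult_ac)
qed

end

section \<open>Large \<open>u\<close>, and the asymptotic expansion\<close>

lemma eventually_powr_le_exp:
  fixes D d k p :: real
  assumes "d > 0" "k > 0"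
  shows "\<forall>\<^sub>F u in at_top. D * u powr p \<le> d * exp (k * u)"
proof -
  define m where "m = nat \<lceil>p\<rceil>"
  have m: "p \<le> real m" unfolding m_def by (rule real_nat_ceiling_ge)
  have ku: "filterlim (\<lambda>u. k * u) at_top at_top"
    using assms(2) by (intro filterlim_tendsto_pos_mult_at_top[OF tendsto_const]) (auto intro: filterlim_ident)
  have "((\<lambda>u. \<bar>D\<bar> / k ^ m * ((k * u) ^ m / exp (k * u))) \<longlongrightarrow> \<bar>D\<bar> / k ^ m * 0) at_top"
    by (intro tendsto_intros filterlim_compose[OF tendsto_power_div_exp_0 ku])
  then have "\<forall>\<^sub>F u in at_top. \<bar>D\<bar> / k ^ m * ((k * u) ^ m / exp (k * u)) < d"
    using assms(1) by (intro order_tendstoD(2)[where y = "\<bar>D\<bar> / k ^ m * 0"]) auto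
  then show ?thesis
    using eventually_ge_at_top[of 1]
  proof eventually_elim
    case (elim u)
    have "D * u powr p \<le> \<bar>D\<bar> * u ^ m"
    proof (rule mult_mono)
      have "u powr p \<le> u powr real m" using elim(2) m by (intro powr_mono) auto
      then show "u powr p \<le> u ^ m" using elim(2) by (simp add: powr_realpow)
    qed auto
    also have "\<dots> = \<bar>D\<bar> / k ^ m * ((k * u) ^ m / exp (k * u)) * exp (k * u)"
      using assms(2) by (simp add: power_mult_distrib)
    also have "\<dots> \<le> d * exp (k * u)"
      using elim(1) by (intro mult_right_mono) auto
    finally show ?case .
  qed
qed

text \<open>The cutoff \<open>Y = N powr (1 / 6)\<close> grows exponentially in \<open>u\<close>,
  whereas every quantity it has to beat, including \<open>- ln (f (exp u))\<close>, is at most of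
  order \<open>u powr (lam + 1)\<close>.\<close>

lemma eventually_saddle:
  assumes \<alpha>: "\<alpha> > 0" and b: "b \<ge> 0" and lam: "lam \<ge> 0"
    and cont: "continuous_on {1..} f"
    and f_pos: "\<And>t. t \<ge> 1 \<Longrightarrow> 0 < f t" and f_le: "\<And>t. t \<ge> 1 \<Longrightarrow> f t \<le> A * t powr b"
    and sc: "suitability_constants f lam fm K M"
  shows "\<forall>\<^sub>F u in at_top. saddle \<alpha> b lam A u ((\<alpha> * exp u) powr (1 / 6)) f fm K M R"
proof -
  obtain m c where m: "m > 0" and c: "c \<ge> 0"
    and lower: "\<And>u. u \<ge> 1 \<Longrightarrow> m * exp (- c * u powr (lam + 1)) \<le> f (exp u)"
    using suitable_lower_bound[OF cont f_pos sc lam] by blast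
  have A: "A > 0" using f_pos[of 1] f_le[of 1] by simp
  \<comment> \<open>Multiplied by \<open>u powr (lam + 1)\<close>, the summands pay in turn for
    \<open>Y \<ge> 32\<close>, for \<open>Y \<ge> 16 * b\<close>, for the three factors of
    \<open>A * exp (u * b) / f (exp u)\<close> after the lower bound on \<open>f\<close>, and for
    \<open>real R * ln N\<close>.\<close>
  define D where "D = 32 + 16 * b + \<bar>ln (A / m)\<bar> + b + c + real R * (\<bar>ln \<alpha>\<bar> + 1)"
  have a6: "\<alpha> powr (1 / 6) > 0" and a3: "\<alpha> powr (1 / 3) > 0" using \<alpha> by auto
  have "\<forall>\<^sub>F u in at_top. D * u powr (lam + 1) \<le> \<alpha> powr (1 / 6) * exp (1 / 6 * u)"
    using a6 by (intro eventually_powr_le_exp) auto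
  \<comment> \<open>This is the condition \<open>Y\<rho>\<close>, because
    \<open>Y / sqrt N = N powr (- 1 / 3)\<close>.\<close>
  moreover have "\<forall>\<^sub>F u in at_top. 2 * u powr lam \<le> \<alpha> powr (1 / 3) * exp (1 / 3 * u)"
    using a3 by (intro eventually_powr_le_exp) auto
  moreover have "\<forall>\<^sub>F u in at_top. u \<ge> max 1 (- ln \<alpha>)" by (rule eventually_ge_at_top)
  ultimately show ?thesis
  proof eventually_elim
    case (elim u)
    define N where "N = \<alpha> * exp u"
    define Y where "Y = N powr (1 / 6)"
    define P where "P = u powr (lam + 1)"
    have u: "u \<ge> 1" using elim(3) by simp
    have Npos: "N > 0" using \<alpha> by (simp add: N_def)
    have lnN: "ln N = ln \<alpha> + u" using \<alpha> by (simp add: N_def ln_mult)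
    have "ln N \<ge> 0" using elim(3) by (simp add: lnN)
    then have N1: "N \<ge> 1" using Npos by simp
    have Npowr: "N powr q = \<alpha> powr q * exp (q * u)" for q
      using \<alpha> by (simp add: N_def powr_def ln_mult distrib_left exp_add)
    have P1: "P \<ge> 1" unfolding P_def using u lam by (simp add: ge_one_powr_ge_zero)
    have Pu: "u \<le> P" unfolding P_def using powr_mono[of 1 "lam + 1" u] u lam by simp
    have scale: "z \<le> z * P" if "z \<ge> 0" for z :: real
      using mult_left_mono[OF P1 that] by simp
    have DY: "D * P \<le> Y" using elim(1) by (simp add: Y_def P_def Npowr)
    have D_split: "D * P = 32 * P + 16 * b * P + \<bar>ln (A / m)\<bar> * P + b * P + c * P + real R * (\<bar>ln \<alpha>\<bar> * P + P)"
      unfolding D_def by (simp add: algebra_simps)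
    have nn: "0 \<le> b * P" "0 \<le> c * P" "0 \<le> \<bar>ln (A / m)\<bar> * P" "0 \<le> real R * (\<bar>ln \<alpha>\<bar> * P + P)"
      using b c P1 by auto
    have lnA: "ln (A / m) \<le> \<bar>ln (A / m)\<bar> * P" using scale[of "\<bar>ln (A / m)\<bar>"] by linarith
    have "ln N \<le> \<bar>ln \<alpha>\<bar> * P + P" using scale[of "\<bar>ln \<alpha>\<bar>"] Pu lnN by linarith
    then have lnN': "real R * ln N \<le> real R * (\<bar>ln \<alpha>\<bar> * P + P)" by (intro mult_left_mono) auto
    have ub: "u * b \<le> b * P" using mult_left_mono[OF Pu b] by (simp add: mult.commute)
    have NR: "1 / N ^ R = exp (- (real R * ln N))"
      using Npos by (simp add: exp_minus exp_of_nat_mult divide_inverse)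
    show ?case
      unfolding N_def[symmetric] Y_def[symmetric]
    proof (unfold_locales, fold N_def)
      show "32 \<le> Y" "16 * b \<le> Y"
        using DY D_split nn P1 scale[of "16 * b"] b by linarith+
      have "Y ^ 3 = N powr (1 / 2)"
        unfolding Y_def using Npos by (simp add: powr_powr flip: powr_realpow)
      then show "Y ^ 3 \<le> sqrt N" using Npos by (simp add: powr_half_sqrt)
      have "Y / sqrt N = N powr (1 / 6 - 1 / 2)"
        unfolding Y_def powr_diff using Npos by (simp add: powr_half_sqrt)
      also have "\<dots> = 1 / N powr (1 / 3)" using Npos by (simp add: powr_minus_divide[symmetric])
      also have "\<dots> \<le> 1 / (2 * u powr lam)"
        using elim(2) u Npos \<alpha> by (intro divide_left_mono mult_pos_pos) (auto simp: Npowr)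
      finally show "Y / sqrt N \<le> 1 / (2 * u powr lam)" .
      show "exp (- Y) \<le> 1 / N ^ R"
      proof -
        have "- Y \<le> - (real R * ln N)" using DY D_split nn P1 lnN' by linarith
        then show ?thesis unfolding NR by simp
      qed
      have "A * exp (u * b) / f (exp u) \<le> A * exp (u * b) / (m * exp (- c * P))"
        using lower[OF u] m A f_pos[of "exp u"] u unfolding P_def
        by (intro divide_left_mono mult_pos_pos) auto
      also have "\<dots> = exp (ln (A / m) + u * b + c * P)"
        using A m by (simp add: exp_add exp_minus field_simps)
      finally have "A * exp (u * b) / f (exp u) * exp (- Y) \<le> exp (ln (A / m) + u * b + c * P) * exp (- Y)"
        by (intro mult_right_mono) auto
      also have "\<dots> = exp (ln (A / m) + u * b + c * P - Y)" by (simp flip: exp_add)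
      also have "\<dots> \<le> exp (- (real R * ln N))"
      proof -
        have "ln (A / m) + u * b + c * P - Y \<le> - (real R * ln N)"
          using DY D_split nn P1 lnN' lnA ub b scale[of "16 * b"] by linarith
        then show ?thesis by simp
      qed
      finally show "A * exp (u * b) / f (exp u) * exp (- Y) \<le> 1 / N ^ R" unfolding NR .
    qed (use b lam cont f_pos f_le sc u N1 in auto)
  qed
qed

lemma suitable_asymptotic_expansion:
  assumes "\<alpha> > 0" and "R \<ge> 1" and "suitable f b lam fm" and sc: "suitability_constants f lam fm K M"
  shows "\<forall>\<^sub>F n in at_top. let u = Lambert_W (n / \<alpha>) in
       \<exists>E. \<bar>E\<bar> \<le> (1 + central_const K R + tail_const M R) * (\<integral>y. exp (- \<bar>y\<bar>) \<partial>lborel) / sqrt (2 * pi) *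
             (u powr (real R * (1 + 2 * lam)) / n ^ R) \<and>
           I_int \<alpha> f n =
             sqrt (2 * pi) * (u powr (n + 1) * f (exp u) * exp (u - n / u) / sqrt ((1 + u) * n)) *
             (1 + (\<Sum>r=1..R-1. a_coeff fm r u / n ^ r) + E)"
proof -
  obtain A where *: "continuous_on {1..} f" "b \<ge> 0" "lam \<ge> 0"
      "\<And>t. t \<ge> 1 \<Longrightarrow> 0 < f t" "\<And>t. t \<ge> 1 \<Longrightarrow> f t \<le> A * t powr b"
    using assms(3) unfolding suitable_def by blast
  have "filterlim (\<lambda>n. Lambert_W (n / \<alpha>)) at_top at_top"
  proof (rule filterlim_compose[OF filterlim_Lambert_W_at_top])
    have "filterlim (\<lambda>n. 1 / \<alpha> * n) at_top at_top"
      using assms(1) by (intro filterlim_tendsto_pos_mult_at_top[OF tendsto_const]) (auto intro: filterlim_ident)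
    then show "filterlim (\<lambda>n. n / \<alpha>) at_top at_top" by simp
  qed
  moreover have "\<forall>\<^sub>F u in at_top. saddle \<alpha> b lam A u ((\<alpha> * exp u) powr (1 / 6)) f fm K M R"
    by (intro eventually_saddle assms *)
  ultimately have "\<forall>\<^sub>F n in at_top. saddle \<alpha> b lam A (Lambert_W (n / \<alpha>))
      ((\<alpha> * exp (Lambert_W (n / \<alpha>))) powr (1 / 6)) f fm K M R"
    by (rule filterlim_iff[THEN iffD1, rule_format])
  then show ?thesis
    using eventually_gt_at_top[of 0]
  proof eventually_elim
    case (elim n)
    define u where "u = Lambert_W (n / \<alpha>)"
    define T where "T = \<alpha> * exp u"
    define J where "J = (\<integral>y. exp (- \<bar>y :: real\<bar>) \<partial>lborel)"
    define p where "p = u powr (n + 1) * f (exp u) * exp (u - n / u) / sqrt ((1 + u) * n)"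
    interpret saddle \<alpha> b lam A u "(\<alpha> * exp u) powr (1 / 6)" f fm K M R "\<alpha> * exp u" "u * (\<alpha> * exp u)"
      "u / sqrt ((u + 1) * (u * (\<alpha> * exp u)))" "u powr lam"
      by (rule elim(1)[folded u_def]) (rule reflexive)+
    \<comment> \<open>The Lambert equation identifies the parameter
      \<open>u * (\<alpha> * exp u)\<close> of the locale with the given \<open>n\<close>.\<close>
    have "u * exp u = n / \<alpha>"
      unfolding u_def using elim(2) assms(1) by (intro Lambert_W_pos_eq) auto
    then have n: "u * T = n" using assms(1) by (simp add: T_def field_simps)
    define E where "E = (integral\<^sup>L lborel kernel - sqrt (2 * pi) * (\<Sum>r<R. a_coeff fm r u / n ^ r)) / sqrt (2 * pi)"
    \<comment> \<open>The term \<open>r = 0\<close> is the leading 1, since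
      \<open>fm 0 u = 1\<close> and \<open>(-1)!! = 1\<close>.\<close>
    have "(\<Sum>r<R. a_coeff fm r u / n ^ r) = 1 + (\<Sum>r=1..R-1. a_coeff fm r u / n ^ r)"
    proof -
      have "a_coeff fm 0 u = 1"
        using suitability_coeff_0[OF sc u f_exp_pos] by (simp add: a_coeff_def bell_hat_def double_fact_def)
      moreover have "{..<R} = insert 0 {1..R-1}" using assms(2) by auto
      ultimately show ?thesis by simp
    qed
    then have "integral\<^sup>L lborel kernel = sqrt (2 * pi) * (1 + (\<Sum>r=1..R-1. a_coeff fm r u / n ^ r) + E)"
      by (simp add: E_def field_simps)
    then have I: "I_int \<alpha> f n = sqrt (2 * pi) * p * (1 + (\<Sum>r=1..R-1. a_coeff fm r u / n ^ r) + E)"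
      using I_int_eq_kernel unfolding T_def[symmetric] n p_def by simp
    have Z: "((u powr lam)\<^sup>2 / T) ^ R = u powr (real R * (1 + 2 * lam)) / n ^ R"
    proof -
      have "T = n / u" using n u by (simp add: field_simps)
      then have "((u powr lam)\<^sup>2 / T) ^ R = ((u powr lam)\<^sup>2 * u) ^ R / n ^ R"
        by (simp add: power_divide)
      also have "(u powr lam)\<^sup>2 * u = u powr (1 + 2 * lam)"
      proof -
        have "(u powr lam)\<^sup>2 * u powr 1 = u powr (lam + lam + 1)"
          unfolding powr_add power2_eq_square ..
        moreover have "lam + lam + 1 = 1 + 2 * lam" by simp
        ultimately show ?thesis using u by (simp add: add.commute)
      qed
      also have "(u powr (1 + 2 * lam)) ^ R = u powr (real R * (1 + 2 * lam))"
        using u by (simp add: powr_power mult.commute)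
      finally show ?thesis .
    qed
    have "\<bar>E\<bar> \<le> (1 + central_const K R + tail_const M R) * J * ((u powr lam)\<^sup>2 / T) ^ R / sqrt (2 * pi)"
      unfolding E_def abs_divide J_def
      using integral_kernel unfolding T_def[symmetric] n
      by (auto intro: divide_right_mono)
    also have "\<dots> = (1 + central_const K R + tail_const M R) * J / sqrt (2 * pi) *
        (u powr (real R * (1 + 2 * lam)) / n ^ R)"
      unfolding Z by simp
    finally show ?case
      using I unfolding Let_def u_def[symmetric] p_def[symmetric] J_def by blast
  qed
qed

text \<open>\<open>C\<close> is quantified before \<open>f\<close>, \<open>lam\<close> and
  \<open>fm\<close>, with the suitability constants \<open>K\<close> and \<open>M\<close> fixed
  beforehand, so the error bound is uniform over all such \<open>f\<close>; only the range of
  admissible \<open>n\<close> varies with \<open>f\<close>. The bound on \<open>a_coeff\<close> is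
  stated for \<open>u \<ge> 1\<close> because the coefficient functions are controlled only
  there.\<close>

theorem theorem5p2:
  fixes \<alpha> b :: real and R :: nat and K M :: "nat \<Rightarrow> real"
  assumes "\<alpha> > 0" and "R \<ge> 1"
  shows "\<exists>C. \<forall>f lam fm. suitable f b lam fm \<and> suitability_constants f lam fm K M \<longrightarrow>
    (\<forall>\<^sub>F n in at_top. let u = Lambert_W (n / \<alpha>) in
       \<exists>E. \<bar>E\<bar> \<le> C * (u powr (real R * (1 + 2 * lam)) / n ^ R) \<and>
           I_int \<alpha> f n =
             sqrt (2 * pi) * (u powr (n + 1) * f (exp u) * exp (u - n / u) / sqrt ((1 + u) * n)) *
             (1 + (\<Sum>r=1..R-1. a_coeff fm r u / n ^ r) + E)) \<and>
    (\<forall>r. \<exists>C'. \<forall>n>0. let u = Lambert_W (n / \<alpha>) in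
       u \<ge> 1 \<longrightarrow> \<bar>a_coeff fm r u\<bar> \<le> C' * u powr (real r * (1 + 2 * lam)))"
proof (intro exI allI impI conjI)
  fix f lam fm assume *: "suitable f b lam fm \<and> suitability_constants f lam fm K M"
  show "\<forall>\<^sub>F n in at_top. let u = Lambert_W (n / \<alpha>) in
       \<exists>E. \<bar>E\<bar> \<le> (1 + central_const K R + tail_const M R) * (\<integral>y. exp (- \<bar>y\<bar>) \<partial>lborel) / sqrt (2 * pi) *
             (u powr (real R * (1 + 2 * lam)) / n ^ R) \<and>
           I_int \<alpha> f n =
             sqrt (2 * pi) * (u powr (n + 1) * f (exp u) * exp (u - n / u) / sqrt ((1 + u) * n)) *
             (1 + (\<Sum>r=1..R-1. a_coeff fm r u / n ^ r) + E)"
    using * assms by (intro suitable_asymptotic_expansion) auto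
  fix r :: nat and n :: real
  have "lam \<ge> 0" using * by (simp add: suitable_def)
  moreover have "\<bar>fm m v\<bar> \<le> M m * v powr (lam * real m)" if "v \<ge> 1" for m v
    using * that unfolding suitability_constants_def by blast
  ultimately show "let u = Lambert_W (n / \<alpha>) in u \<ge> 1 \<longrightarrow> \<bar>a_coeff fm r u\<bar> \<le>
      (\<Sum>j=0..2*r. \<bar>of_int (double_fact (2 * int j + 2 * int r - 1)) / fact j\<bar> *
        (\<Sum>i=j..2*r. 16 ^ j * 8 ^ i * M (2*r - i))) * u powr (real r * (1 + 2 * lam))"
    unfolding Let_def by (intro impI a_coeff_bound) auto
qed

end
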